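(* For each of the following superpotentials (the $\widehat{O},\widehat{A},\widehat{D},\widehat{E}$ cases of the Intriligator–Wecht classification), let $\widehat{\mathcal{M}}$ be the resolved geometry obtained by gluing two copies of $\mathbb{C}^3$ with coordinates $(\gamma,w_1,w_2)$ and $(\beta,v_1,v_2)$ by $$\beta=1/\gamma,\qquad v_1=\gamma^{-1}w_1,\qquad v_2=\gamma^{3}w_2+\partial_{w_1}E(\gamma,w_1)$$ with the indicated perturbation term. The corresponding singular geometries $\mathcal{M}_0$ are: 1. $\widehat{O}$: $W(x,y)=0$, $\partial_{w_1}E=0$: $\ \mathcal{M}_0=\mathbb{C}^3/\mathbb{Z}_3$. 2. $\widehat{A}$: $W(x,y)=\frac12y^2$, $\partial_{w_1}E=\gamma^2w_1$: $\ \mathcal{M}_0=\mathbb{C}\times\mathbb{C}^2/\mathbb{Z}_2$. 3. $\widehat{D}$: $W(x,y)=xy^2$, $\partial_{w_1}E=\gamma w_1^2$: $\ \mathcal{M}_0=\{X^2+Y^2Z-T^3=0\}\subset\mathbb{C}^4$. 4. $\widehat{E}$: $W(x,y)=\frac13y^3$, $\partial_{w_1}E=\gamma^2w_1^2$: $\ \mathcal{M}_0=\operatorname{Spec}\,\big(\mathbb{C}[a,b,u,v]^{\mathbb{Z}_2}\big)/(b^4-u^2-av)$, i.e. the hypersurface $b^4-u^2-av=0$ in $\mathbb{C}^4/\mathbb{Z}_2$.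
   Context: Relation between $W$ and the perturbation: $W(x,y)$ is the coefficient of $\gamma^2$ in $E(\gamma,x+\gamma y)$, with the potentials considered up to interchanging $x$ and $y$ (interchanging $x$ and $y$ replaces a perturbation term $\gamma^nw_1^m$ by $\gamma^{3-n-m}w_1^m$). The geometry $\widehat{\mathcal{M}}$ is the one defined by the perturbation term given. Group actions: $\mathbb{Z}_3$ acts on $\mathbb{C}^3$ by multiplying all coordinates by a primitive cube root of unity; $\mathbb{Z}_2$ acts on $\mathbb{C}^2$ by $-1$ and on $\mathbb{C}^4$ (coordinates $a,b,u,v$) diagonally by $-1$. The singular geometry corresponding to $\widehat{\mathcal{M}}$ is its blow-down: $\mathcal{M}_0$ is the affine variety whose coordinate ring is the ring of global holomorphic functions on $\widehat{\mathcal{M}}$, i.e. polynomials in $\mathbb{C}[\beta,v_1,v_2]$ which, after substitution of the transition functions, are also polynomials in $\mathbb{C}[\gamma,w_1,w_2]$. *)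

theory Defs
  imports
    Complex_Main
    "HOL-Computational_Algebra.Polynomial"
    "HOL-Algebra.QuotRing"
begin

(* Polynomials in several variables are iterated univariate polynomials: C[x,y] = C[x][y], etc.,
   so the first variable is innermost and the last one outermost. *)

definition eval2 :: "complex poly poly \<Rightarrow> complex \<Rightarrow> complex \<Rightarrow> complex" where
  "eval2 p x y = poly (poly p [:y:]) x"

definition eval3 :: "complex poly poly poly \<Rightarrow> complex \<Rightarrow> complex \<Rightarrow> complex \<Rightarrow> complex" where
  "eval3 p x y z = eval2 (poly p [:[:z:]:]) x y"

definition eval4 ::
  "complex poly poly poly poly \<Rightarrow> complex \<Rightarrow> complex \<Rightarrow> complex \<Rightarrow> complex \<Rightarrow> complex" where
  "eval4 p x y z t = eval3 (poly p [:[:[:t:]:]:]) x y z"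

definition x1 :: "complex poly poly poly poly" where "x1 = [:[:[:[:0, 1:]:]:]:]"
definition x2 :: "complex poly poly poly poly" where "x2 = [:[:[:0, 1:]:]:]"
definition x3 :: "complex poly poly poly poly" where "x3 = [:[:0, 1:]:]"
definition x4 :: "complex poly poly poly poly" where "x4 = [:0, 1:]"

lemma eval4_coordinates:
  "eval4 x1 a b c d = a" "eval4 x2 a b c d = b" "eval4 x3 a b c d = c" "eval4 x4 a b c d = d"
  by (simp_all add: eval4_def eval3_def eval2_def x1_def x2_def x3_def x4_def)

(* A complex algebra is a ring together with its structure map from the complex numbers.
   Affine varieties over C are compared through their coordinate rings as C-algebras;
   a bare ring isomorphism need not be C-linear. *)

type_synonym 'a calg = "'a ring \<times> (complex \<Rightarrow> 'a)"

definition calg_iso :: "'a calg \<Rightarrow> 'b calg \<Rightarrow> bool" (infix "\<cong>\<^sub>C" 50) where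
  "A \<cong>\<^sub>C B \<longleftrightarrow> (\<exists>h \<in> ring_iso (fst A) (fst B). \<forall>c. h (snd A c) = snd B c)"

definition ring_on :: "'a::comm_ring_1 set \<Rightarrow> 'a ring" where
  "ring_on S = \<lparr>carrier = S, monoid.mult = (*), one = 1, ring.zero = 0, add = (+)\<rparr>"

definition calg3 :: "complex poly poly poly set \<Rightarrow> complex poly poly poly calg" where
  "calg3 S = (ring_on S, \<lambda>c. [:[:[:c:]:]:])"

definition calg4 :: "complex poly poly poly poly set \<Rightarrow> complex poly poly poly poly calg" where
  "calg4 S = (ring_on S, \<lambda>c. [:[:[:[:c:]:]:]:])"

definition calg_quot :: "'a calg \<Rightarrow> 'a \<Rightarrow> 'a set calg" where
  "calg_quot A f =
    (let R = fst A; I = PIdl\<^bsub>R\<^esub> f in (R Quot I, \<lambda>c. I +>\<^bsub>R\<^esub> snd A c))"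

(* Z_k acts on C^n as the group of all k-th roots of unity, by scalar multiplication;
   the coordinate ring of C^n / Z_k is the ring of invariant polynomials. *)

definition invariants2 :: "nat \<Rightarrow> complex poly poly set" where
  "invariants2 k =
    {p. \<forall>\<zeta>. \<zeta> ^ k = 1 \<longrightarrow> (\<forall>x y. eval2 p (\<zeta> * x) (\<zeta> * y) = eval2 p x y)}"

definition invariants3 :: "nat \<Rightarrow> complex poly poly poly set" where
  "invariants3 k =
    {p. \<forall>\<zeta>. \<zeta> ^ k = 1 \<longrightarrow>
      (\<forall>x y z. eval3 p (\<zeta> * x) (\<zeta> * y) (\<zeta> * z) = eval3 p x y z)}"

definition invariants4 :: "nat \<Rightarrow> complex poly poly poly poly set" where
  "invariants4 k =
    {p. \<forall>\<zeta>. \<zeta> ^ k = 1 \<longrightarrow>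
      (\<forall>x y z t. eval4 p (\<zeta> * x) (\<zeta> * y) (\<zeta> * z) (\<zeta> * t) = eval4 p x y z t)}"

(* For A a ring of functions on X, the polynomials over A: the coordinate ring A[t] of C x X,
   with t the outermost variable. *)

definition polys_over :: "'a::zero set \<Rightarrow> 'a poly set" where
  "polys_over A = {p. \<forall>i. coeff p i \<in> A}"

(* A perturbation E is a polynomial in gamma (inner variable) and w1 (outer variable). Thus
   pderiv E is the partial derivative in w1, the polynomial gamma^n * w1^m is
   monom (monom 1 n) m, and poly E [:x, y:] is E(gamma, x + gamma * y) as a polynomial
   in gamma. *)

definition superpotential :: "complex poly poly \<Rightarrow> complex \<Rightarrow> complex \<Rightarrow> complex" where
  "superpotential E x y = coeff (poly E [:x, y:]) 2"

definition has_superpotential ::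
  "complex poly poly \<Rightarrow> (complex \<Rightarrow> complex \<Rightarrow> complex) \<Rightarrow> bool" where
  "has_superpotential E W \<longleftrightarrow>
    superpotential E = W \<or> superpotential E = (\<lambda>x y. W y x)"

(* Global functions on the two glued charts, written in the chart (beta, v1, v2): the polynomials p
   which on the overlap gamma \<noteq> 0 agree with a polynomial q in (gamma, w1, w2). *)

definition global_functions :: "complex poly poly \<Rightarrow> complex poly poly poly set" where
  "global_functions E =
    {p. \<exists>q. \<forall>\<gamma> w1 w2. \<gamma> \<noteq> 0 \<longrightarrow>
       eval3 p (1 / \<gamma>) (inverse \<gamma> * w1) (\<gamma> ^ 3 * w2 + eval2 (pderiv E) \<gamma> w1)
         = eval3 q \<gamma> w1 w2}"

definition blow_down :: "complex poly poly \<Rightarrow> complex poly poly poly calg" where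
  "blow_down E = calg3 (global_functions E)"

end

theory Submission
  imports Defs "HOL-Computational_Algebra.Factorial_Ring"
begin

text \<open>In every case the coordinate functions of \<open>\<M>\<^sub>0\<close> are parametrized by
  \<open>\<beta>, v\<^sub>1\<close> and a root \<open>s\<close> of \<open>v\<^sub>2 = s ^ k\<close>:
  \<open>(\<beta>s, v\<^sub>1s, s)\<close> with \<open>k = 3\<close> for \<open>O\<close>, \<open>(\<beta>s, s, v\<^sub>1 - \<beta>\<^sup>3s\<^sup>2)\<close> with \<open>k = 2\<close> for \<open>A\<close>,
  \<open>(v\<^sub>1s, s, \<beta>\<^sup>3s - v\<^sub>1\<^sup>2, \<beta>s)\<close> with \<open>k = 1\<close> for \<open>D\<close>, and
  \<open>(s, \<beta>s, v\<^sub>1s, s(\<beta>\<^sup>4s\<^sup>2 - v\<^sub>1\<^sup>2))\<close> with \<open>k = 2\<close> for \<open>E\<close>.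
  Writing also \<open>s = \<gamma>r\<close>, invariance under \<open>\<int>\<^sub>k\<close> turns pullbacks into polynomials in both charts.
  Conversely, \<open>\<beta>, v\<^sub>1, v\<^sub>2\<close> and \<open>\<gamma>, w\<^sub>1, w\<^sub>2\<close> are rational functions of the coordinates of
  \<open>\<M>\<^sub>0\<close> with denominators vanishing together only in codimension two, so a global function
  extends. The hypersurfaces for \<open>D\<close> and \<open>E\<close> are double covers \<open>u\<^sup>2 = D\<close> of affine
  three-space, which reduces this extension to three variables and shows, by division by
  \<open>u\<^sup>2 - D\<close>, that the kernel of the pullback is principal.\<close>

subsection \<open>Polynomials as functions\<close>

definition t1 :: "complex poly poly poly" where "t1 = [:[:[:0, 1:]:]:]"
definition t2 :: "complex poly poly poly" where "t2 = [:[:0, 1:]:]"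
definition t3 :: "complex poly poly poly" where "t3 = [:0, 1:]"

lemma eval3_coordinates [simp]:
  "eval3 t1 a b c = a" "eval3 t2 a b c = b" "eval3 t3 a b c = c"
  by (simp_all add: eval3_def eval2_def t1_def t2_def t3_def)

declare eval4_coordinates [simp]

lemma eval2_ring_hom [simp]:
  "eval2 (p + q) x y = eval2 p x y + eval2 q x y"
  "eval2 (p - q) x y = eval2 p x y - eval2 q x y"
  "eval2 (- p) x y = - eval2 p x y"
  "eval2 (p * q) x y = eval2 p x y * eval2 q x y"
  "eval2 (p ^ n) x y = eval2 p x y ^ n"
  "eval2 0 x y = 0" "eval2 1 x y = 1" "eval2 [:[:c:]:] x y = c"
  by (simp_all add: eval2_def poly_power)

lemma eval3_ring_hom [simp]:
  "eval3 (p + q) x y z = eval3 p x y z + eval3 q x y z"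
  "eval3 (p - q) x y z = eval3 p x y z - eval3 q x y z"
  "eval3 (- p) x y z = - eval3 p x y z"
  "eval3 (p * q) x y z = eval3 p x y z * eval3 q x y z"
  "eval3 (p ^ n) x y z = eval3 p x y z ^ n"
  "eval3 0 x y z = 0" "eval3 1 x y z = 1" "eval3 [:r:] x y z = eval2 r x y"
  by (simp_all add: eval3_def poly_power)

lemma eval4_ring_hom [simp]:
  "eval4 (p + q) x y z t = eval4 p x y z t + eval4 q x y z t"
  "eval4 (p - q) x y z t = eval4 p x y z t - eval4 q x y z t"
  "eval4 (- p) x y z t = - eval4 p x y z t"
  "eval4 (p * q) x y z t = eval4 p x y z t * eval4 q x y z t"
  "eval4 (p ^ n) x y z t = eval4 p x y z t ^ n"
  "eval4 0 x y z t = 0" "eval4 1 x y z t = 1" "eval4 [:r:] x y z t = eval3 r x y z"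
  by (simp_all add: eval4_def poly_power)

lemma eval4_pCons: "eval4 (pCons r p) x y z t = eval3 r x y z + t * eval4 p x y z t"
  by (simp add: eval4_def eval3_def eval2_def)

section \<open>Polynomial identities tested by values\<close>

lemma poly_eqI_infinite:
  fixes p q :: "'a::idom poly"
  assumes "infinite S" "\<And>s. s \<in> S \<Longrightarrow> poly p s = poly q s"
  shows "p = q"
proof (rule ccontr)
  assume "p \<noteq> q"
  then have "finite {s. poly (p - q) s = 0}"
    by (intro poly_roots_finite) simp
  moreover have "S \<subseteq> {s. poly (p - q) s = 0}"
    using assms(2) by auto
  ultimately show False
    using assms(1) finite_subset by blast
qed

text \<open>The constants alone are infinitely many points of the coefficient domain, so testing at
  scalars suffices; this strips one variable at a time.\<close>

lemma poly_eqI_const: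
  fixes p q :: "'a::{idom, ring_char_0} poly poly"
  assumes "\<And>c. poly p [:c:] = poly q [:c:]"
  shows "p = q"
proof (rule poly_eqI_infinite)
  show "infinite (range (\<lambda>c::'a. [:c:]))"
    by (simp add: finite_image_iff inj_def infinite_UNIV_char_0)
qed (use assms in auto)

lemma eval2_eqI: "(\<And>x y. eval2 p x y = eval2 q x y) \<Longrightarrow> p = q"
  by (rule poly_eqI_const, subst poly_eq_poly_eq_iff [symmetric]) (auto simp: eval2_def)

lemma eval3_eqI:
  assumes "\<And>x y z. eval3 p x y z = eval3 q x y z"
  shows "p = q"
proof (rule poly_eqI_infinite)
  show "infinite (range (\<lambda>c::complex. [:[:c:]:]))"
    by (simp add: finite_image_iff inj_def infinite_UNIV_char_0)
  fix s :: "complex poly poly" assume "s \<in> range (\<lambda>c. [:[:c:]:])"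
  then show "poly p s = poly q s"
    using assms by (auto simp: eval3_def intro: eval2_eqI)
qed

lemma eval4_eqI:
  assumes "\<And>x y z t. eval4 p x y z t = eval4 q x y z t"
  shows "p = q"
proof (rule poly_eqI_infinite)
  show "infinite (range (\<lambda>c::complex. [:[:[:c:]:]:]))"
    by (simp add: finite_image_iff inj_def infinite_UNIV_char_0)
  fix s :: "complex poly poly poly" assume "s \<in> range (\<lambda>c. [:[:[:c:]:]:])"
  then show "poly p s = poly q s"
    using assms by (auto simp: eval4_def intro: eval3_eqI)
qed

text \<open>\<open>d * p\<close> and \<open>d * q\<close> agree everywhere, since both vanish where
  \<open>d\<close> does, and \<open>d\<close> cancels in a domain.\<close>

lemma eval3_eqI_dense:
  assumes "d \<noteq> 0" "\<And>x y z. eval3 d x y z \<noteq> 0 \<Longrightarrow> eval3 p x y z = eval3 q x y z"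
  shows "p = q"
proof -
  have "d * p = d * q"
    using assms(2) by (intro eval3_eqI) auto
  then show ?thesis
    using assms(1) by simp
qed

lemma t3_nonzero: "t3 \<noteq> 0"
  by (simp add: t3_def)

lemma eval3_eqI_third:
  "(\<And>x y z. z \<noteq> 0 \<Longrightarrow> eval3 p x y z = eval3 q x y z) \<Longrightarrow> p = q"
  using eval3_eqI_dense [OF t3_nonzero] by simp

section \<open>Induction over ring generators, and substitution\<close>

lemma poly_ring_induct [case_names const var add mult]:
  fixes p :: "'a::comm_ring_1 poly"
  assumes "\<And>c. P [:c:]" "P [:0, 1:]"
    and "\<And>p q. P p \<Longrightarrow> P q \<Longrightarrow> P (p + q)" "\<And>p q. P p \<Longrightarrow> P q \<Longrightarrow> P (p * q)"
  shows "P p"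
proof (induction p)
  case 0
  then show ?case using assms(1) [of 0] by simp
next
  case (pCons a p)
  have "pCons a p = [:a:] + [:0, 1:] * p" by simp
  then show ?case using assms pCons by metis
qed

text \<open>Each layer of the iterated polynomial ring is generated by its variable over the layer
  below, so the univariate rule is applied once per layer, innermost first.\<close>

lemma poly3_induct [case_names const t1 t2 t3 add mult]:
  assumes const: "\<And>c. P [:[:[:c:]:]:]" and "P t1" "P t2" "P t3"
    and add: "\<And>p q. P p \<Longrightarrow> P q \<Longrightarrow> P (p + q)" and mult: "\<And>p q. P p \<Longrightarrow> P q \<Longrightarrow> P (p * q)"
  shows "P p"
proof (rule poly_ring_induct [of P])
  have "P [:[:c:]:]" for c
    by (induction c rule: poly_ring_induct)
      (use assms add [of "[:[:_:]:]" "[:[:_:]:]"] mult [of "[:[:_:]:]" "[:[:_:]:]"] in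
        \<open>auto simp: t1_def\<close>)
  then show "P [:c:]" for c
    by (induction c rule: poly_ring_induct)
      (use assms add [of "[:_:]" "[:_:]"] mult [of "[:_:]" "[:_:]"] in \<open>auto simp: t2_def\<close>)
qed (use assms in \<open>auto simp: t3_def\<close>)

lemma poly4_induct [case_names const x1 x2 x3 x4 add mult]:
  assumes const: "\<And>c. P [:[:[:[:c:]:]:]:]" and "P x1" "P x2" "P x3" "P x4"
    and add: "\<And>p q. P p \<Longrightarrow> P q \<Longrightarrow> P (p + q)" and mult: "\<And>p q. P p \<Longrightarrow> P q \<Longrightarrow> P (p * q)"
  shows "P p"
proof (rule poly_ring_induct [of P])
  show "P [:c:]" for c
    by (induction c rule: poly3_induct)
      (use assms add [of "[:_:]" "[:_:]"] mult [of "[:_:]" "[:_:]"] in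
        \<open>auto simp: t1_def t2_def t3_def x1_def x2_def x3_def\<close>)
qed (use assms in \<open>auto simp: x4_def\<close>)

text \<open>Composition is handled through values: having a polynomial with the composed values is a
  property that passes through sums and products.\<close>

lemma subst33:
  "\<exists>r. \<forall>x y z. eval3 r x y z = eval3 p (eval3 q1 x y z) (eval3 q2 x y z) (eval3 q3 x y z)"
proof (induction p rule: poly3_induct)
  case (const c) show ?case by (rule exI [of _ "[:[:[:c:]:]:]"]) simp
next
  case (add p q) then show ?case by (metis eval3_ring_hom(1))
next
  case (mult p q) then show ?case by (metis eval3_ring_hom(4))
qed auto

lemma subst34:
  "\<exists>r. \<forall>x y z t. eval4 r x y z t
     = eval3 p (eval4 q1 x y z t) (eval4 q2 x y z t) (eval4 q3 x y z t)"
proof (induction p rule: poly3_induct)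
  case (const c) show ?case by (rule exI [of _ "[:[:[:[:c:]:]:]:]"]) simp
next
  case (add p q) then show ?case by (metis eval4_ring_hom(1) eval3_ring_hom(1))
next
  case (mult p q) then show ?case by (metis eval4_ring_hom(4) eval3_ring_hom(4))
qed auto

lemma subst43:
  "\<exists>r. \<forall>x y z. eval3 r x y z
     = eval4 p (eval3 q1 x y z) (eval3 q2 x y z) (eval3 q3 x y z) (eval3 q4 x y z)"
proof (induction p rule: poly4_induct)
  case (const c) show ?case by (rule exI [of _ "[:[:[:c:]:]:]"]) simp
next
  case (add p q) then show ?case by (metis eval4_ring_hom(1) eval3_ring_hom(1))
next
  case (mult p q) then show ?case by (metis eval4_ring_hom(4) eval3_ring_hom(4))
qed auto

lemma subst44:
  "\<exists>r. \<forall>x y z t. eval4 r x y z t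
     = eval4 p (eval4 q1 x y z t) (eval4 q2 x y z t) (eval4 q3 x y z t) (eval4 q4 x y z t)"
proof (induction p rule: poly4_induct)
  case (const c) show ?case by (rule exI [of _ "[:[:[:[:c:]:]:]:]"]) simp
next
  case (add p q) then show ?case by (metis eval4_ring_hom(1))
next
  case (mult p q) then show ?case by (metis eval4_ring_hom(4))
qed auto

text \<open>Clearing denominators: each variable costs one factor \<open>d\<close>, and the
  exponents are added for sums as well as for products.\<close>

lemma subst34_fraction:
  "\<exists>N g. \<forall>x y z t. eval4 d x y z t \<noteq> 0 \<longrightarrow> eval4 g x y z t = eval4 d x y z t ^ N *
     eval3 p (eval4 n1 x y z t / eval4 d x y z t) (eval4 n2 x y z t / eval4 d x y z t)
       (eval4 n3 x y z t / eval4 d x y z t)"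
  (is "\<exists>N g. ?R N g p")
proof (induction p rule: poly3_induct)
  case (const c)
  show ?case by (rule exI [of _ 0], rule exI [of _ "[:[:[:[:c:]:]:]:]"]) simp
next
  case t1
  show ?case by (rule exI [of _ 1], rule exI [of _ n1]) simp
next
  case t2
  show ?case by (rule exI [of _ 1], rule exI [of _ n2]) simp
next
  case t3
  show ?case by (rule exI [of _ 1], rule exI [of _ n3]) simp
next
  case (add p q)
  then obtain N g M h where "?R N g p" "?R M h q" by blast
  then have "?R (N + M) (d ^ M * g + d ^ N * h) (p + q)"
    by (simp add: power_add algebra_simps)
  then show ?case by blast
next
  case (mult p q)
  then obtain N g M h where "?R N g p" "?R M h q" by blast
  then have "?R (N + M) (g * h) (p * q)"
    by (simp add: power_add algebra_simps)
  then show ?case by blast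
qed

subsection \<open>Double covers and cyclic covers\<close>

lemma prime_elem_X: "prime_elem [:0, 1 :: 'a::idom:]"
proof (rule prime_elemI)
  show "\<not> [:0, 1 :: 'a:] dvd 1"
    by (metis minus_zero one_neq_zero poly_1 poly_eq_0_iff_dvd)
  fix a b :: "'a poly" assume "[:0, 1:] dvd a * b"
  then show "[:0, 1:] dvd a \<or> [:0, 1:] dvd b"
    using poly_eq_0_iff_dvd [of _ "0::'a"] by (metis minus_zero mult_eq_0_iff poly_mult)
qed simp

text \<open>Hartogs' principle: if \<open>p / z ^ N = q / x ^ M\<close>, this function is regular off
  the set \<open>x = z = 0\<close> of codimension two, hence a polynomial.\<close>

lemma hartogs:
  assumes "t1 ^ M * p = t3 ^ N * q"
  obtains r where "p = t3 ^ N * r"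
proof (cases "N = 0")
  case False
  \<comment> \<open>\<open>t1\<close> is a scalar for the outermost variable, so
    \<open>t1 ^ M\<close> stays nonzero at \<open>t3 = 0\<close>. As \<open>t3\<close> is prime,
    \<open>t3 ^ N\<close> must divide \<open>p\<close>.\<close>
  have "\<not> [:0, 1:] dvd t1 ^ M"
    unfolding poly_eq_0_iff_dvd [of _ 0, simplified, symmetric]
    by (simp add: t1_def poly_power)
  moreover have "[:0, 1:] ^ N dvd t1 ^ M * p"
    by (simp add: assms t3_def)
  ultimately show ?thesis
    using prime_power_dvd_multD [OF prime_elem_X] False that by (metis dvdE t3_def neq0_conv)
qed (use that [of p] in simp)

text \<open>Division by the monic \<open>u^2 - D\<close>, run as Horner's scheme in
  \<open>u\<close>: a remainder \<open>p0 + u * p1\<close> times \<open>u\<close> is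
  \<open>D * p1 + u * p0\<close> plus \<open>p1\<close> times the divisor.\<close>

lemma double_cover_division:
  "\<exists>p0 p1 q. \<forall>x y z u. eval4 p x y z u =
     eval3 p0 x y z + u * eval3 p1 x y z + (u\<^sup>2 - eval3 D x y z) * eval4 q x y z u"
proof (induction p)
  case 0
  have "\<forall>x y z u. eval4 0 x y z u =
     eval3 0 x y z + u * eval3 0 x y z + (u\<^sup>2 - eval3 D x y z) * eval4 0 x y z u"
    by simp
  then show ?case by blast
next
  case (pCons r p)
  then obtain p0 p1 q where *: "\<And>x y z u. eval4 p x y z u =
     eval3 p0 x y z + u * eval3 p1 x y z + (u\<^sup>2 - eval3 D x y z) * eval4 q x y z u"
    by blast
  have "\<forall>x y z u. eval4 (pCons r p) x y z u =
     eval3 (r + D * p1) x y z + u * eval3 p0 x y z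
       + (u\<^sup>2 - eval3 D x y z) * eval4 (pCons p1 q) x y z u"
    unfolding eval4_pCons * by (simp add: algebra_simps power2_eq_square)
  then show ?case by blast
qed

text \<open>Independence of \<open>1\<close> and \<open>u\<close> over the base: \<open>u\<close>
  and \<open>- u\<close> lie over the same point, and adding the two relations eliminates
  \<open>u\<close>. The argument also covers squares \<open>D\<close>, such as
  \<open>D = 1\<close>.\<close>

lemma double_cover_zero:
  assumes "D \<noteq> 0" "d \<noteq> 0"
    and zero: "\<And>x y z u. eval3 d x y z \<noteq> 0 \<Longrightarrow> u\<^sup>2 = eval3 D x y z \<Longrightarrow>
      eval3 p0 x y z + u * eval3 p1 x y z = 0"
  shows "p0 = 0" "p1 = 0"
proof -
  have *: "eval3 p0 x y z = 0 \<and> eval3 D x y z * eval3 p1 x y z = 0"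
    if "eval3 d x y z \<noteq> 0" for x y z
  proof -
    define u where "u = csqrt (eval3 D x y z)"
    have u: "u\<^sup>2 = eval3 D x y z" "(- u)\<^sup>2 = eval3 D x y z"
      by (simp_all add: u_def)
    have eq: "eval3 p0 x y z + u * eval3 p1 x y z = 0" "eval3 p0 x y z - u * eval3 p1 x y z = 0"
      using zero [OF that u(1)] zero [OF that u(2)] by simp_all
    have "2 * eval3 p0 x y z = 0"
      using arg_cong2 [OF eq, of "(+)"] by simp
    moreover from this eq(1) have "u * eval3 p1 x y z = 0"
      by simp
    \<comment> \<open>One more factor \<open>u\<close> turns the square root into the polynomial
      \<open>D\<close>.\<close>
    then have "u\<^sup>2 * eval3 p1 x y z = 0"
      by auto
    ultimately show ?thesis
      by (simp add: u)
  qed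
  show "p0 = 0"
    using * by (intro eval3_eqI_dense [OF assms(2)]) simp
  have "D * p1 = 0"
    using * by (intro eval3_eqI_dense [OF assms(2)]) simp
  then show "p1 = 0"
    using assms(1) by simp
qed

text \<open>The remainder modulo \<open>u^2 - D\<close> vanishes on a dense part of the cover, hence
  is zero.\<close>

lemma vanishing_on_double_cover:
  assumes "D \<noteq> 0" "d \<noteq> 0"
    and zero: "\<And>x y z u. eval3 d x y z \<noteq> 0 \<Longrightarrow> u\<^sup>2 = eval3 D x y z \<Longrightarrow> eval4 p x y z u = 0"
  obtains q where "\<And>x y z u. eval4 p x y z u = (u\<^sup>2 - eval3 D x y z) * eval4 q x y z u"
proof -
  obtain p0 p1 q where p: "\<And>x y z u. eval4 p x y z u =
     eval3 p0 x y z + u * eval3 p1 x y z + (u\<^sup>2 - eval3 D x y z) * eval4 q x y z u"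
    using double_cover_division by blast
  have "eval3 p0 x y z + u * eval3 p1 x y z = 0"
    if "eval3 d x y z \<noteq> 0" "u\<^sup>2 = eval3 D x y z" for x y z u
    using p [of x y z u] zero [OF that] that(2) by simp
  then have "p0 = 0" "p1 = 0"
    using double_cover_zero [OF assms(1,2)] by blast+
  then show thesis
    using that [of q] p by simp
qed

lemma t1_t3_nonzero: "t1 * t3 \<noteq> 0"
  by (simp add: t1_def t3_def)

text \<open>Below, \<open>z\<close> and \<open>x\<close> are the denominators of the coordinates of the two charts
  (\<open>\<beta>, v\<^sub>1, v\<^sub>2\<close> and \<open>\<gamma>, w\<^sub>1, w\<^sub>2\<close>), written as functions on a double cover.\<close>

lemma glued_function_extends:
  assumes "D \<noteq> 0"
    and glue: "\<And>x y z u. x \<noteq> 0 \<Longrightarrow> z \<noteq> 0 \<Longrightarrow> u\<^sup>2 = eval3 D x y z \<Longrightarrow>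
      eval3 p (eval4 n1 x y z u / z) (eval4 n2 x y z u / z) (eval4 n3 x y z u / z) =
      eval3 q (eval4 m1 x y z u / x) (eval4 m2 x y z u / x) (eval4 m3 x y z u / x)"
  obtains f0 f1 where "\<And>x y z u. z \<noteq> 0 \<Longrightarrow> u\<^sup>2 = eval3 D x y z \<Longrightarrow>
      eval3 f0 x y z + u * eval3 f1 x y z =
      eval3 p (eval4 n1 x y z u / z) (eval4 n2 x y z u / z) (eval4 n3 x y z u / z)"
proof -
  obtain N g where g: "\<And>x y z u. z \<noteq> 0 \<Longrightarrow> eval4 g x y z u = z ^ N *
      eval3 p (eval4 n1 x y z u / z) (eval4 n2 x y z u / z) (eval4 n3 x y z u / z)"
    using subst34_fraction [of x3 p n1 n2 n3] unfolding eval4_coordinates by blast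
  obtain M h where h: "\<And>x y z u. x \<noteq> 0 \<Longrightarrow> eval4 h x y z u = x ^ M *
      eval3 q (eval4 m1 x y z u / x) (eval4 m2 x y z u / x) (eval4 m3 x y z u / x)"
    using subst34_fraction [of x1 q m1 m2 m3] unfolding eval4_coordinates by blast
  obtain g0 g1 where "\<exists>r. \<forall>x y z u. eval4 g x y z u = eval3 g0 x y z + u * eval3 g1 x y z
      + (u\<^sup>2 - eval3 D x y z) * eval4 r x y z u"
    using double_cover_division [of g D] by blast
  then have g': "eval4 g x y z u = eval3 g0 x y z + u * eval3 g1 x y z"
    if "u\<^sup>2 = eval3 D x y z" for x y z u
    using that by fastforce
  obtain h0 h1 where "\<exists>r. \<forall>x y z u. eval4 h x y z u = eval3 h0 x y z + u * eval3 h1 x y z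
      + (u\<^sup>2 - eval3 D x y z) * eval4 r x y z u"
    using double_cover_division [of h D] by blast
  then have h': "eval4 h x y z u = eval3 h0 x y z + u * eval3 h1 x y z"
    if "u\<^sup>2 = eval3 D x y z" for x y z u
    using that by fastforce
  \<comment> \<open>Cross-multiplying the cleared expressions on the overlap and separating
    \<open>1\<close> from \<open>u\<close> gives two polynomial identities of the shape that
    \<open>hartogs\<close> takes.\<close>
  have "eval3 (t1 ^ M * g0 - t3 ^ N * h0) x y z + u * eval3 (t1 ^ M * g1 - t3 ^ N * h1) x y z = 0"
    if "eval3 (t1 * t3) x y z \<noteq> 0" and u: "u\<^sup>2 = eval3 D x y z" for x y z u
  proof -
    have nz: "x \<noteq> 0" "z \<noteq> 0" using that by auto
    have "x ^ M * eval4 g x y z u = z ^ N * eval4 h x y z u"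
      using g [OF nz(2)] h [OF nz(1)] glue [OF nz u] by simp
    then show ?thesis
      by (simp add: g' [OF u] h' [OF u] algebra_simps)
  qed
  then have "t1 ^ M * g0 - t3 ^ N * h0 = 0" "t1 ^ M * g1 - t3 ^ N * h1 = 0"
    using double_cover_zero [OF \<open>D \<noteq> 0\<close> t1_t3_nonzero] by blast+
  then obtain f0 f1 where f: "g0 = t3 ^ N * f0" "g1 = t3 ^ N * f1"
    by (metis eq_iff_diff_eq_0 hartogs)
  have "eval3 f0 x y z + u * eval3 f1 x y z =
      eval3 p (eval4 n1 x y z u / z) (eval4 n2 x y z u / z) (eval4 n3 x y z u / z)"
    if "z \<noteq> 0" and u: "u\<^sup>2 = eval3 D x y z" for x y z u
  proof -
    have "z ^ N * (eval3 f0 x y z + u * eval3 f1 x y z) = z ^ N *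
      eval3 p (eval4 n1 x y z u / z) (eval4 n2 x y z u / z) (eval4 n3 x y z u / z)"
      using g [OF that(1)] g' [OF u] by (simp add: f algebra_simps)
    then show ?thesis using that(1) by simp
  qed
  then show thesis using that by blast
qed

section \<open>Averaging over roots of unity\<close>

lemma sum_powers_roots_of_unity:
  assumes "k > 0"
  shows "(\<Sum>\<zeta> | \<zeta> ^ k = 1. \<zeta> ^ n) = (if k dvd n then of_nat k else (0::complex))"
proof (cases "k dvd n")
  case True
  then obtain m where "n = k * m" ..
  then have "(\<Sum>\<zeta> | \<zeta> ^ k = (1::complex). \<zeta> ^ n) = (\<Sum>\<zeta> | \<zeta> ^ k = (1::complex). 1)"
    by (intro sum.cong) (simp_all add: power_mult)
  then show ?thesis
    using True assms by (simp add: card_roots_unity_eq)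
next
  case False
  let ?f = "\<lambda>j. cis (2 * pi * real j / real k)"
  define \<omega> where "\<omega> = ?f 1"
  have bij: "bij_betw ?f {..<k} {\<zeta>. \<zeta> ^ k = 1}"
    by (rule bij_betw_roots_unity [OF assms])
  have pow: "\<omega> ^ j = ?f j" for j
    by (simp add: \<omega>_def DeMoivre mult_ac)
  have k1: "\<omega> ^ k = 1"
    using assms by (simp add: pow)
  \<comment> \<open>The parametrization \<open>?f\<close> of the roots is known to be injective for
    exponents below \<open>k\<close>, hence the reduction of \<open>n\<close>.\<close>
  have "\<omega> ^ n = \<omega> ^ (n mod k)"
    by (metis k1 div_mult_mod_eq mult.commute mult_1 power_add power_mult power_one)
  moreover have "?f (n mod k) \<noteq> ?f 0"
    using bij_betw_imp_inj_on [OF bij] assms False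
    by (metis inj_on_contraD lessThan_iff mod_eq_0_iff_dvd mod_less_divisor)
  ultimately have ne: "\<omega> ^ n \<noteq> 1"
    by (simp add: pow)
  have "\<omega> \<noteq> 0"
    by (simp add: \<omega>_def)
  \<comment> \<open>Multiplication by \<open>\<omega>\<close> permutes the roots yet scales the sum
    by \<open>\<omega> ^ n\<close>, which is not 1; so the sum is zero.\<close>
  have "bij_betw ((*) \<omega>) {\<zeta>. \<zeta> ^ k = 1} {\<zeta>. \<zeta> ^ k = 1}"
    by (rule bij_betw_byWitness [where f' = "\<lambda>\<zeta>. \<zeta> / \<omega>"])
      (use \<open>\<omega> \<noteq> 0\<close> k1 in \<open>auto simp: power_mult_distrib power_divide\<close>)
  then have "(\<Sum>\<zeta> | \<zeta> ^ k = 1. \<zeta> ^ n) = (\<Sum>\<zeta> | \<zeta> ^ k = 1. (\<omega> * \<zeta>) ^ n)"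
    by (rule sum.reindex_bij_betw [symmetric])
  also have "\<dots> = \<omega> ^ n * (\<Sum>\<zeta> | \<zeta> ^ k = 1. \<zeta> ^ n)"
    by (simp add: power_mult_distrib sum_distrib_left)
  finally show ?thesis
    using ne False by simp
qed

text \<open>Averaging over \<open>\<zeta>\<close> removes the powers \<open>u ^ n\<close> with
  \<open>k\<close> not dividing \<open>n\<close>; in the remaining ones \<open>u ^ k\<close> becomes
  \<open>D\<close>.\<close>

lemma invariant_descends_to_base:
  assumes "k > 0"
    and inv: "\<And>\<zeta> x y z u. \<zeta> ^ k = 1 \<Longrightarrow> u ^ k = eval3 D x y z \<Longrightarrow>
      eval4 p x y z (\<zeta> * u) = eval4 p x y z u"
  obtains q where "\<And>x y z u. u ^ k = eval3 D x y z \<Longrightarrow> eval4 p x y z u = eval3 q x y z"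
proof -
  define q where "q = (\<Sum>n\<le>degree p. if k dvd n then coeff p n * D ^ (n div k) else 0)"
  have sum3: "eval3 (sum f A) x y z = (\<Sum>a\<in>A. eval3 (f a) x y z)" for f :: "nat \<Rightarrow> _" and A x y z
    by (induction A rule: infinite_finite_induct) simp_all
  have expand: "eval4 p x y z u = (\<Sum>n\<le>degree p. eval3 (coeff p n) x y z * u ^ n)" for x y z u
    by (simp add: eval4_def poly_altdef sum3 eval2_def)
  have "eval4 p x y z u = eval3 q x y z" if u: "u ^ k = eval3 D x y z" for x y z u
  proof -
    have "of_nat k * eval4 p x y z u = (\<Sum>\<zeta> | \<zeta> ^ k = (1::complex). eval4 p x y z u)"
      by (simp add: card_roots_unity_eq assms(1))
    also have "\<dots> = (\<Sum>\<zeta> | \<zeta> ^ k = 1. eval4 p x y z (\<zeta> * u))"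
      by (intro sum.cong) (simp_all add: inv u)
    also have "\<dots> = (\<Sum>n\<le>degree p. \<Sum>\<zeta> | \<zeta> ^ k = 1. eval3 (coeff p n) x y z * (\<zeta> * u) ^ n)"
      by (subst sum.swap) (simp add: expand)
    also have "\<dots> = (\<Sum>n\<le>degree p. eval3 (coeff p n) x y z * u ^ n * (\<Sum>\<zeta> | \<zeta> ^ k = 1. \<zeta> ^ n))"
      by (simp add: sum_distrib_left power_mult_distrib mult_ac)
    also have "\<dots> = (\<Sum>n\<le>degree p. of_nat k *
        eval3 (if k dvd n then coeff p n * D ^ (n div k) else 0) x y z)"
      by (intro sum.cong)
        (auto simp: sum_powers_roots_of_unity assms(1) u [symmetric] simp flip: power_mult)
    also have "\<dots> = of_nat k * eval3 q x y z"
      by (simp add: q_def sum3 sum_distrib_left)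
    finally show ?thesis
      using assms(1) by simp
  qed
  then show thesis using that by blast
qed

lemma complex_root_exists:
  fixes c :: complex
  assumes "k > 0"
  obtains s where "s ^ k = c"
proof (cases "c = 0")
  case False
  then have "{s. s ^ k = c} \<noteq> {}"
    using card_nth_roots [OF False assms] assms by fastforce
  then show ?thesis using that by blast
qed (use that [of 0] assms in simp)

subsection \<open>Coordinate rings\<close>

lemma ring_on_simps [simp]:
  "carrier (ring_on S) = S" "x \<otimes>\<^bsub>ring_on S\<^esub> y = x * y" "\<one>\<^bsub>ring_on S\<^esub> = 1"
  "\<zero>\<^bsub>ring_on S\<^esub> = 0" "x \<oplus>\<^bsub>ring_on S\<^esub> y = x + y"
  by (simp_all add: ring_on_def)

definition closed_ring :: "'a::comm_ring_1 set \<Rightarrow> bool" where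
  "closed_ring S \<longleftrightarrow> 1 \<in> S \<and> (\<forall>x\<in>S. \<forall>y\<in>S. x - y \<in> S \<and> x * y \<in> S)"

lemma closed_ringD:
  assumes "closed_ring S"
  shows "1 \<in> S" "0 \<in> S" "x \<in> S \<Longrightarrow> y \<in> S \<Longrightarrow> x * y \<in> S" "x \<in> S \<Longrightarrow> - x \<in> S"
    "x \<in> S \<Longrightarrow> y \<in> S \<Longrightarrow> x + y \<in> S"
proof -
  have diff: "x - y \<in> S" if "x \<in> S" "y \<in> S" for x y
    using assms that by (simp add: closed_ring_def)
  show "1 \<in> S" using assms by (simp add: closed_ring_def)
  then show zero: "0 \<in> S" using diff [of 1 1] by simp
  show neg: "- x \<in> S" if "x \<in> S" for x using diff [OF zero that] by simp
  show "x * y \<in> S" if "x \<in> S" "y \<in> S" using assms that by (simp add: closed_ring_def)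
  show "x + y \<in> S" if "x \<in> S" "y \<in> S" using diff [OF that(1) neg [OF that(2)]] by simp
qed

section \<open>Algebra isomorphisms from surjective homomorphisms\<close>

lemma cring_ring_on:
  assumes "closed_ring S"
  shows "cring (ring_on S)"
proof (rule cringI)
  note closed = closed_ringD [OF assms]
  show "abelian_group (ring_on S)"
    by (rule abelian_groupI)
      (use closed in \<open>auto simp: algebra_simps intro!: bexI [of _ "- _"]\<close>)
  show "Group.comm_monoid (ring_on S)"
    by (rule comm_monoidI) (use closed in \<open>auto simp: algebra_simps\<close>)
qed (simp add: algebra_simps)

text \<open>Lets \<open>global_functions E\<close> inherit its ring structure through a surjection
  onto it.\<close>

lemma closed_ring_image:
  assumes S: "closed_ring S" and h: "h \<in> ring_hom (ring_on S) (ring_on (h ` S))"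
  shows "closed_ring (h ` S)"
proof -
  note closed = closed_ringD [OF S]
  have hom: "h 1 = 1" "\<And>x y. x \<in> S \<Longrightarrow> y \<in> S \<Longrightarrow> h (x * y) = h x * h y"
    "\<And>x y. x \<in> S \<Longrightarrow> y \<in> S \<Longrightarrow> h (x + y) = h x + h y"
    using ring_hom_memE [OF h] by auto
  have diff: "h x - h y = h (x - y)" if "x \<in> S" "y \<in> S" for x y
    using hom(3) [of "x - y" y] that S by (simp add: closed_ring_def)
  show ?thesis
    unfolding closed_ring_def
  proof (intro conjI ballI)
    show "1 \<in> h ` S"
      using closed(1) hom(1) by (metis imageI)
    fix a b assume "a \<in> h ` S" "b \<in> h ` S"
    then obtain x y where xy: "a = h x" "b = h y" "x \<in> S" "y \<in> S" by blast
    have "x - y \<in> S" using S xy by (simp add: closed_ring_def)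
    then show "a - b \<in> h ` S" using xy by (simp add: diff)
    have "h (x * y) \<in> h ` S" using closed(3) xy by blast
    then show "a * b \<in> h ` S" using xy by (simp add: hom(2))
  qed
qed

text \<open>First isomorphism theorem, compatible with the structure maps. The image
  \<open>G\<close> is the source of the claimed isomorphism, so the inverse of the induced map is
  exhibited.\<close>

lemma calg_iso_quotI:
  assumes S: "closed_ring S" and f: "f \<in> S" and \<kappa>: "\<And>c. \<kappa> c \<in> S"
    and h: "h \<in> ring_hom (ring_on S) (ring_on G)" "h ` S = G" "\<And>c. h (\<kappa> c) = \<mu> c"
    and ker: "\<And>p. p \<in> S \<Longrightarrow> h p = 0 \<longleftrightarrow> (\<exists>q\<in>S. p = q * f)"
  shows "(ring_on G, \<mu>) \<cong>\<^sub>C calg_quot (ring_on S, \<kappa>) f"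
proof -
  let ?R = "ring_on S" and ?I = "PIdl\<^bsub>ring_on S\<^esub> f"
  interpret R: cring ?R by (rule cring_ring_on [OF S])
  have "closed_ring G"
    using closed_ring_image [OF S] h by blast
  then interpret B: cring "ring_on G" by (rule cring_ring_on)
  interpret ring_hom_ring ?R "ring_on G" h
    by (rule ring_hom_ringI2) (use h R.ring_axioms B.ring_axioms in auto)
  \<comment> \<open>\<open>h\<close> is constant on each coset of its kernel, so the image of a
    coset is a singleton.\<close>
  let ?g = "\<lambda>X. the_elem (h ` X)"
  have kernel: "a_kernel ?R (ring_on G) h = ?I"
    unfolding a_kernel_def' cgenideal_def using f ker closed_ringD(3) [OF S] by auto
  have g: "?g \<in> ring_iso (?R Quot ?I) (ring_on G)"
    using FactRing_iso_set h(2) by (simp add: kernel)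
  let ?k = "inv_into (carrier (?R Quot ?I)) ?g"
  have "ring (?R Quot ?I)"
    by (rule ideal.quotient_is_ring [OF R.cgenideal_ideal]) (simp add: f)
  then have iso: "?k \<in> ring_iso (ring_on G) (?R Quot ?I)"
    using g by (rule ring_iso_set_sym)
  have "?k (\<mu> c) = ?I +>\<^bsub>?R\<^esub> \<kappa> c" for c
  proof (rule inv_into_f_eq)
    show "inj_on ?g (carrier (?R Quot ?I))"
      using ring_iso_memE(5) [OF g] by (rule bij_betw_imp_inj_on)
    show "?I +>\<^bsub>?R\<^esub> \<kappa> c \<in> carrier (?R Quot ?I)"
      unfolding FactRing_simps using \<kappa> by (auto simp: a_r_coset_def)
    show "?g (?I +>\<^bsub>?R\<^esub> \<kappa> c) = \<mu> c"
      using the_elem_simp [of "\<kappa> c"] \<kappa> h(3) by (simp add: kernel)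
  qed
  with iso show ?thesis
    unfolding calg_iso_def calg_quot_def Let_def by auto
qed

text \<open>The case of zero kernel, with the ring itself as target instead of its quotient by the
  zero ideal.\<close>

lemma calg_iso_injI:
  assumes S: "closed_ring S" and \<kappa>: "\<And>c. \<kappa> c \<in> S"
    and h: "h \<in> ring_hom (ring_on S) (ring_on G)" "h ` S = G" "\<And>c. h (\<kappa> c) = \<mu> c"
    and ker: "\<And>p. p \<in> S \<Longrightarrow> h p = 0 \<Longrightarrow> p = 0"
  shows "(ring_on G, \<mu>) \<cong>\<^sub>C (ring_on S, \<kappa>)"
proof -
  interpret R: cring "ring_on S" by (rule cring_ring_on [OF S])
  have "closed_ring G"
    using closed_ring_image [OF S] h by blast
  then interpret B: cring "ring_on G" by (rule cring_ring_on)
  have add: "h (p + q) = h p + h q" if "p \<in> S" "q \<in> S" for p q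
    using ring_hom_memE(3) [OF h(1)] that by auto
  have "inj_on h S"
  proof (rule inj_onI)
    fix p q assume pq: "p \<in> S" "q \<in> S" "h p = h q"
    have "p - q \<in> S" using S pq by (simp add: closed_ring_def)
    moreover from this have "h (p - q) = 0"
      using add [of "p - q" q] pq by simp
    ultimately show "p = q" using ker by fastforce
  qed
  then have "h \<in> ring_iso (ring_on S) (ring_on G)"
    using h by (simp add: ring_iso_def bij_betw_def)
  then have "inv_into S h \<in> ring_iso (ring_on G) (ring_on S)"
    using ring_iso_set_sym [OF R.ring_axioms] by fastforce
  moreover have "inv_into S h (\<mu> c) = \<kappa> c" for c
    using \<open>inj_on h S\<close> \<kappa> h(3) by (simp add: inv_into_f_eq)
  ultimately show ?thesis
    unfolding calg_iso_def by auto
qed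

section \<open>Evaluation homomorphisms onto the global functions\<close>

lemma global_functions_iff:
  "p \<in> global_functions E \<longleftrightarrow> (\<exists>q. \<forall>\<gamma> w1 w2. \<gamma> \<noteq> 0 \<longrightarrow>
     eval3 p (1 / \<gamma>) (w1 / \<gamma>) (\<gamma> ^ 3 * w2 + eval2 (pderiv E) \<gamma> w1) = eval3 q \<gamma> w1 w2)"
  by (simp add: global_functions_def divide_inverse mult.commute [of "inverse _"])

lemma eval2_monom: "eval2 (monom (monom 1 n) m) x y = x ^ n * y ^ m"
  by (simp add: eval2_def poly_monom poly_power)

text \<open>As \<open>v\<^sub>2\<close> ranges over all powers \<open>s ^ k\<close>, a polynomial in \<open>\<beta>, v\<^sub>1, v\<^sub>2\<close> is determined by its
  pullback to \<open>\<beta>, v\<^sub>1, s\<close>, even off \<open>s = 0\<close>; so lifting the point evaluations of \<open>f\<close> to such a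
  polynomial is compatible with sums and products.\<close>

lemma evaluation_hom_exists:
  fixes ev :: "'a::comm_ring_1 \<Rightarrow> complex \<Rightarrow> complex \<Rightarrow> complex \<Rightarrow> complex"
  assumes S: "closed_ring S" and \<kappa>: "\<And>c. \<kappa> c \<in> S" and "k > 0"
    and ev: "\<And>p q b v s. ev (p + q) b v s = ev p b v s + ev q b v s"
      "\<And>p q b v s. ev (p * q) b v s = ev p b v s * ev q b v s"
      "\<And>b v s. ev 1 b v s = 1" "\<And>c b v s. ev (\<kappa> c) b v s = c"
    and into: "\<And>f. f \<in> S \<Longrightarrow> \<exists>p\<in>G. \<forall>b v s. eval3 p b v (s ^ k) = ev f b v s"
    and onto: "\<And>p. p \<in> G \<Longrightarrow> \<exists>f\<in>S. \<forall>b v s. s \<noteq> 0 \<longrightarrow> eval3 p b v (s ^ k) = ev f b v s"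
  obtains h where "h \<in> ring_hom (ring_on S) (ring_on G)" "h ` S = G"
    "\<And>c. h (\<kappa> c) = [:[:[:c:]:]:]"
    "\<And>f. f \<in> S \<Longrightarrow> h f = 0 \<longleftrightarrow> (\<forall>b v s. s \<noteq> 0 \<longrightarrow> ev f b v s = 0)"
proof -
  have unique: "p = q" if "\<And>b v s. s \<noteq> 0 \<Longrightarrow> eval3 p b v (s ^ k) = eval3 q b v (s ^ k)" for p q
  proof (rule eval3_eqI_third)
    fix b v w :: complex assume "w \<noteq> 0"
    obtain s where s: "s ^ k = w" using complex_root_exists [OF \<open>k > 0\<close>] .
    then have "s \<noteq> 0" using \<open>w \<noteq> 0\<close> \<open>k > 0\<close> by auto
    then show "eval3 p b v w = eval3 q b v w" using that s by blast
  qed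
  \<comment> \<open>\<open>h\<close> merely chooses lifts; \<open>unique\<close> makes the choice
    respect sums, products and scalars.\<close>
  obtain h where hG: "\<And>f. f \<in> S \<Longrightarrow> h f \<in> G"
    and h: "\<And>f b v s. f \<in> S \<Longrightarrow> eval3 (h f) b v (s ^ k) = ev f b v s"
    using into by metis
  note closed = closed_ringD [OF S]
  show thesis
  proof (rule that [of h])
    show "h \<in> ring_hom (ring_on S) (ring_on G)"
      by (rule ring_hom_memI) (auto simp: hG h ev closed intro!: unique)
    show "h ` S = G"
    proof
      show "G \<subseteq> h ` S"
      proof
        fix p assume "p \<in> G"
        then obtain f where f: "f \<in> S" "\<And>b v s. s \<noteq> 0 \<Longrightarrow> eval3 p b v (s ^ k) = ev f b v s"
          using onto by blast
        then have "p = h f" by (intro unique) (simp add: h)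
        with f(1) show "p \<in> h ` S" by blast
      qed
    qed (use hG in auto)
    show "h (\<kappa> c) = [:[:[:c:]:]:]" for c
      by (rule unique) (simp add: h \<kappa> ev)
    show "h f = 0 \<longleftrightarrow> (\<forall>b v s. s \<noteq> 0 \<longrightarrow> ev f b v s = 0)" if "f \<in> S" for f
    proof
      assume "\<forall>b v s. s \<noteq> 0 \<longrightarrow> ev f b v s = 0"
      then show "h f = 0" by (intro unique) (simp add: h that)
    qed (use h [OF that] in \<open>metis eval3_ring_hom(6)\<close>)
  qed
qed

text \<open>A polynomial in \<open>t\<close> is determined by its values, so invariance at every
  \<open>t\<close> is invariance of each coefficient.\<close>

lemma polys_over_invariants2_iff:
  "p \<in> polys_over (invariants2 k) \<longleftrightarrow>
     (\<forall>\<zeta>. \<zeta> ^ k = 1 \<longrightarrow> (\<forall>x y t. eval3 p (\<zeta> * x) (\<zeta> * y) t = eval3 p x y t))"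
proof -
  have expand: "eval3 p x y t = poly (map_poly (\<lambda>r. eval2 r x y) p) t" for x y t
  proof (induction p)
    case (pCons r p)
    then show ?case by (simp add: map_poly_pCons eval3_def eval2_def)
  qed simp
  have coeff: "coeff (map_poly (\<lambda>r. eval2 r x y) p) i = eval2 (coeff p i) x y" for x y i
    by (simp add: coeff_map_poly)
  have "(\<forall>t. eval3 p (\<zeta> * x) (\<zeta> * y) t = eval3 p x y t) \<longleftrightarrow>
      (\<forall>i. eval2 (coeff p i) (\<zeta> * x) (\<zeta> * y) = eval2 (coeff p i) x y)" for \<zeta> x y
    unfolding expand coeff [symmetric] poly_eq_iff [symmetric]
    by (simp add: fun_eq_iff flip: poly_eq_poly_eq_iff)
  then show ?thesis
    unfolding polys_over_def invariants2_def by blast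
qed

subsection \<open>The four geometries\<close>

lemma root_power_eq_1: "(\<zeta> * s) ^ k = s ^ k" if "\<zeta> ^ k = 1" for \<zeta> s :: complex
  by (simp add: power_mult_distrib that)

text \<open>With \<open>s = \<gamma> * r\<close> and \<open>r ^ 3 = w2\<close>, the coordinates
  \<open>(\<beta> * s, v * s, s)\<close> become \<open>(r, w1 * r, \<gamma> * r)\<close>: polynomial
  in either chart up to the choice of a cube root.\<close>

lemma blow_down_O:
  assumes "pderiv E = 0"
  shows "blow_down E \<cong>\<^sub>C calg3 (invariants3 3)"
proof -
  let ?ev = "\<lambda>f \<beta> v s. eval3 f (\<beta> * s) (v * s) s"
  have glob: "p \<in> global_functions E \<longleftrightarrow> (\<exists>q. \<forall>\<gamma> w1 w2. \<gamma> \<noteq> 0 \<longrightarrow>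
     eval3 p (1 / \<gamma>) (w1 / \<gamma>) (\<gamma> ^ 3 * w2) = eval3 q \<gamma> w1 w2)" for p
    by (simp add: global_functions_iff assms)
  have inv: "f \<in> invariants3 3 \<longleftrightarrow> (\<forall>\<zeta>. \<zeta> ^ 3 = 1 \<longrightarrow>
      (\<forall>x y z. eval3 f (\<zeta> * x) (\<zeta> * y) (\<zeta> * z) = eval3 f x y z))" for f
    by (simp add: invariants3_def)
  have S: "closed_ring (invariants3 3)"
    by (simp add: closed_ring_def inv)
  have into: "\<exists>p\<in>global_functions E. \<forall>\<beta> v s. eval3 p \<beta> v (s ^ 3) = ?ev f \<beta> v s"
    if f: "f \<in> invariants3 3" for f
  proof -
    have f': "eval3 f (x * (\<zeta> * s)) (y * (\<zeta> * s)) (z * (\<zeta> * s)) = eval3 f (x * s) (y * s) (z * s)"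
      if "\<zeta> ^ 3 = 1" for \<zeta> x y z s
    proof -
      have "eval3 f (\<zeta> * (x * s)) (\<zeta> * (y * s)) (\<zeta> * (z * s)) = eval3 f (x * s) (y * s) (z * s)"
        using f that inv by blast
      then show ?thesis by (simp only: mult.left_commute [of _ \<zeta> s])
    qed
    \<comment> \<open>The formula for \<open>g\<close> does not involve \<open>w\<close>, which is
      the base coordinate of the cover \<open>s ^ 3 = w\<close> along which \<open>g\<close>
      descends.\<close>
    obtain g where g: "\<And>\<beta> v w s. eval4 g \<beta> v w s = ?ev f \<beta> v s"
      using subst34 [of f "x1 * x4" "x2 * x4" x4] by auto
    have g_inv: "eval4 g \<beta> v w (\<zeta> * s) = eval4 g \<beta> v w s" if "\<zeta> ^ 3 = 1" for \<zeta> \<beta> v w s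
      using f' [OF that, of \<beta> s v 1] by (simp add: g)
    obtain p where p: "\<And>\<beta> v w s. s ^ 3 = w \<Longrightarrow> eval4 g \<beta> v w s = eval3 p \<beta> v w"
      by (rule invariant_descends_to_base [of 3 t3 g]) (simp_all add: g_inv)
    obtain g' where g': "\<And>\<gamma> w1 w2 r. eval4 g' \<gamma> w1 w2 r = eval3 f r (w1 * r) (\<gamma> * r)"
      using subst34 [of f x4 "x2 * x4" "x1 * x4"] by auto
    have g'_inv: "eval4 g' \<gamma> w1 w2 (\<zeta> * r) = eval4 g' \<gamma> w1 w2 r" if "\<zeta> ^ 3 = 1" for \<zeta> \<gamma> w1 w2 r
      using f' [OF that, of 1 r w1 \<gamma>] by (simp add: g')
    obtain q where q: "\<And>\<gamma> w1 w2 r. r ^ 3 = w2 \<Longrightarrow> eval4 g' \<gamma> w1 w2 r = eval3 q \<gamma> w1 w2"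
      by (rule invariant_descends_to_base [of 3 t3 g']) (simp_all add: g'_inv)
    have "eval3 p (1 / \<gamma>) (w1 / \<gamma>) (\<gamma> ^ 3 * w2) = eval3 q \<gamma> w1 w2" if "\<gamma> \<noteq> 0" for \<gamma> w1 w2
    proof -
      obtain r where r: "r ^ 3 = w2" using complex_root_exists [of 3] by auto
      then have "(\<gamma> * r) ^ 3 = \<gamma> ^ 3 * w2" by (simp add: power_mult_distrib)
      then have "eval3 p (1 / \<gamma>) (w1 / \<gamma>) (\<gamma> ^ 3 * w2) = ?ev f (1 / \<gamma>) (w1 / \<gamma>) (\<gamma> * r)"
        using p g by metis
      also have "\<dots> = eval4 g' \<gamma> w1 w2 r"
        unfolding g' using that by simp
      finally show ?thesis
        using q [OF r] by simp
    qed
    then have "p \<in> global_functions E" unfolding glob by blast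
    then show ?thesis using p by (auto simp: g)
  qed
  have onto: "\<exists>f\<in>invariants3 3. \<forall>\<beta> v s. s \<noteq> 0 \<longrightarrow> eval3 p \<beta> v (s ^ 3) = ?ev f \<beta> v s"
    if global: "p \<in> global_functions E" for p
  proof -
    obtain q where q: "\<And>\<gamma> w1 w2. \<gamma> \<noteq> 0 \<Longrightarrow>
        eval3 p (1 / \<gamma>) (w1 / \<gamma>) (\<gamma> ^ 3 * w2) = eval3 q \<gamma> w1 w2"
      using global unfolding glob by blast
    \<comment> \<open>The parametrization inverted: \<open>\<beta> = x / z\<close>,
      \<open>v1 = y / z\<close>, \<open>v2 = z ^ 3\<close>, and \<open>w2 = x ^ 3\<close> in the
      other chart. Writing \<open>z ^ 4 / z\<close> and \<open>x ^ 4 / x\<close> gives each chart a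
      single denominator.\<close>
    have glue: "eval3 p (x / z) (y / z) (z ^ 4 / z) = eval3 q (z / x) (y / x) (x ^ 4 / x)"
      if "x \<noteq> 0" "z \<noteq> 0" for x y z
    proof -
      have "(z / x) ^ 3 * x ^ 3 = z ^ 4 / z" "x ^ 4 / x = x ^ 3"
        using that by (simp_all add: power_divide power4_eq_xxxx power3_eq_cube)
      then show ?thesis
        using q [of "z / x" "y / x" "x ^ 3"] that by simp
    qed
    \<comment> \<open>\<open>D = 1\<close> is the trivial double cover; its sheet
      \<open>u = 1\<close> is affine three-space itself.\<close>
    obtain f0 f1 where f: "\<And>x y z u. z \<noteq> 0 \<Longrightarrow> u\<^sup>2 = 1 \<Longrightarrow>
        eval3 f0 x y z + u * eval3 f1 x y z = eval3 p (x / z) (y / z) (z ^ 4 / z)"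
      by (rule glued_function_extends [of 1 p x1 x2 "x3 ^ 4" q x3 x2 "x1 ^ 4"]) (use glue in auto)
    have f': "eval3 (f0 + f1) x y z = eval3 p (x / z) (y / z) (z ^ 3)" if "z \<noteq> 0" for x y z
      using f [OF that, of 1] that by (simp add: power4_eq_xxxx power3_eq_cube)
    \<comment> \<open>By \<open>f'\<close> the values depend only on ratios and
      \<open>z ^ 3\<close>, which gives invariance off \<open>z = 0\<close>; density does the
      rest.\<close>
    have "eval3 (f0 + f1) (\<zeta> * x) (\<zeta> * y) (\<zeta> * z) = eval3 (f0 + f1) x y z" if \<zeta>: "\<zeta> ^ 3 = 1" for \<zeta> x y z
    proof -
      have "\<zeta> \<noteq> 0" using \<zeta> by auto
      obtain g where g: "\<And>x y z. eval3 g x y z = eval3 (f0 + f1) (\<zeta> * x) (\<zeta> * y) (\<zeta> * z)"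
        using subst33 [of "f0 + f1" "[:[:[:\<zeta>:]:]:] * t1" "[:[:[:\<zeta>:]:]:] * t2" "[:[:[:\<zeta>:]:]:] * t3"]
        unfolding eval3_ring_hom eval3_coordinates eval2_ring_hom by blast
      have "g = f0 + f1"
        by (rule eval3_eqI_third)
          (simp only: g, simp add: f' \<open>\<zeta> \<noteq> 0\<close> power_mult_distrib \<zeta> del: eval3_ring_hom)
      then show ?thesis using g by metis
    qed
    then have "f0 + f1 \<in> invariants3 3" unfolding inv by blast
    then show ?thesis
      by (intro bexI [of _ "f0 + f1"]) (simp_all add: f' del: eval3_ring_hom)
  qed
  obtain h where h: "h \<in> ring_hom (ring_on (invariants3 3)) (ring_on (global_functions E))"
    "h ` invariants3 3 = global_functions E" "\<And>c. h [:[:[:c:]:]:] = [:[:[:c:]:]:]"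
    "\<And>f. f \<in> invariants3 3 \<Longrightarrow> h f = 0 \<longleftrightarrow> (\<forall>\<beta> v s. s \<noteq> 0 \<longrightarrow> ?ev f \<beta> v s = 0)"
    by (rule evaluation_hom_exists [of _ "\<lambda>c. [:[:[:c:]:]:]" 3 ?ev, OF S _ _ _ _ _ _ into onto])
      (auto simp: inv)
  have "f = 0" if "f \<in> invariants3 3" "h f = 0" for f
  proof (rule eval3_eqI_third)
    \<comment> \<open>Every point with \<open>z \<noteq> 0\<close> is a value of the
      parametrization.\<close>
    have "?ev f (x / z) (y / z) z = 0" if "z \<noteq> 0" for x y z
      using h(4) \<open>f \<in> invariants3 3\<close> \<open>h f = 0\<close> that by blast
    then show "eval3 f x y z = eval3 0 x y z" if "z \<noteq> 0" for x y z
      using that by simp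
  qed
  then show ?thesis
    unfolding blow_down_def calg3_def
    by (intro calg_iso_injI [OF S _ h(1-3)]) (auto simp: inv)
qed

lemma t2_nonzero: "t2 \<noteq> 0"
  by (simp add: t2_def)

text \<open>Here \<open>v2 = \<gamma>^2 * (\<gamma> * w2 + w1)\<close>, so
  \<open>s = \<gamma> * r\<close> with \<open>r^2 = \<gamma> * w2 + w1\<close>. In the second chart
  the coordinates are \<open>(r, \<gamma> * r, - w2)\<close>, as \<open>w1\<close> cancels from
  \<open>v1 - \<beta>^3 * s^2\<close>.\<close>

lemma blow_down_A:
  assumes "pderiv E = monom (monom 1 2) 1"
  shows "blow_down E \<cong>\<^sub>C calg3 (polys_over (invariants2 2))"
proof -
  let ?S = "polys_over (invariants2 2)"
  let ?ev = "\<lambda>f \<beta> v s. eval3 f (\<beta> * s) s (v - \<beta> ^ 3 * s\<^sup>2)"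
  have glob: "p \<in> global_functions E \<longleftrightarrow> (\<exists>q. \<forall>\<gamma> w1 w2. \<gamma> \<noteq> 0 \<longrightarrow>
     eval3 p (1 / \<gamma>) (w1 / \<gamma>) (\<gamma> ^ 3 * w2 + \<gamma>\<^sup>2 * w1) = eval3 q \<gamma> w1 w2)" for p
    by (simp add: global_functions_iff assms eval2_monom)
  note inv = polys_over_invariants2_iff
  have S: "closed_ring ?S"
    by (simp add: closed_ring_def inv)
  have into: "\<exists>p\<in>global_functions E. \<forall>\<beta> v s. eval3 p \<beta> v (s\<^sup>2) = ?ev f \<beta> v s"
    if f: "f \<in> ?S" for f
  proof -
    have f': "eval3 f (x * (\<zeta> * s)) (y * (\<zeta> * s)) t = eval3 f (x * s) (y * s) t"
      if "\<zeta>\<^sup>2 = 1" for \<zeta> x y t s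
    proof -
      have "eval3 f (\<zeta> * (x * s)) (\<zeta> * (y * s)) t = eval3 f (x * s) (y * s) t"
        using f that inv by blast
      then show ?thesis by (simp only: mult.left_commute [of _ \<zeta> s])
    qed
    obtain g where g: "\<And>\<beta> v w s. eval4 g \<beta> v w s = ?ev f \<beta> v s"
      using subst34 [of f "x1 * x4" x4 "x2 - x1 ^ 3 * x4\<^sup>2"] by auto
    have g_inv: "eval4 g \<beta> v w (\<zeta> * s) = eval4 g \<beta> v w s" if "\<zeta>\<^sup>2 = 1" for \<zeta> \<beta> v w s
      using f' [OF that, of \<beta> s 1] by (simp add: g root_power_eq_1 [OF that])
    obtain p where p: "\<And>\<beta> v w s. s\<^sup>2 = w \<Longrightarrow> eval4 g \<beta> v w s = eval3 p \<beta> v w"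
      by (rule invariant_descends_to_base [of 2 t3 g]) (simp_all add: g_inv)
    obtain g' where g': "\<And>\<gamma> w1 w2 r. eval4 g' \<gamma> w1 w2 r = eval3 f r (\<gamma> * r) (- w2)"
      using subst34 [of f x4 "x1 * x4" "- x3"] by auto
    have g'_inv: "eval4 g' \<gamma> w1 w2 (\<zeta> * r) = eval4 g' \<gamma> w1 w2 r" if "\<zeta>\<^sup>2 = 1" for \<zeta> \<gamma> w1 w2 r
      using f' [OF that, of 1 r \<gamma>] by (simp add: g')
    obtain q where q: "\<And>\<gamma> w1 w2 r. r\<^sup>2 = \<gamma> * w2 + w1 \<Longrightarrow> eval4 g' \<gamma> w1 w2 r = eval3 q \<gamma> w1 w2"
      by (rule invariant_descends_to_base [of 2 "t1 * t3 + t2" g']) (simp_all add: g'_inv)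
    have "eval3 p (1 / \<gamma>) (w1 / \<gamma>) (\<gamma> ^ 3 * w2 + \<gamma>\<^sup>2 * w1) = eval3 q \<gamma> w1 w2"
      if "\<gamma> \<noteq> 0" for \<gamma> w1 w2
    proof -
      obtain r where r: "r\<^sup>2 = \<gamma> * w2 + w1" using complex_root_exists [of 2] by auto
      then have s: "(\<gamma> * r)\<^sup>2 = \<gamma> ^ 3 * w2 + \<gamma>\<^sup>2 * w1"
        by (simp add: power_mult_distrib algebra_simps power2_eq_square power3_eq_cube)
      have "w1 / \<gamma> - (1 / \<gamma>) ^ 3 * (\<gamma> * r)\<^sup>2 = - w2"
        unfolding s using that by (simp add: field_simps power2_eq_square power3_eq_cube)
      then have "?ev f (1 / \<gamma>) (w1 / \<gamma>) (\<gamma> * r) = eval4 g' \<gamma> w1 w2 r"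
        unfolding g' using that by simp
      moreover have "eval3 p (1 / \<gamma>) (w1 / \<gamma>) (\<gamma> ^ 3 * w2 + \<gamma>\<^sup>2 * w1) =
          ?ev f (1 / \<gamma>) (w1 / \<gamma>) (\<gamma> * r)"
        using p [OF s] g by metis
      ultimately show ?thesis
        using q [OF r] by simp
    qed
    then have "p \<in> global_functions E" unfolding glob by blast
    then show ?thesis using p by (auto simp: g)
  qed
  have onto: "\<exists>f\<in>?S. \<forall>\<beta> v s. s \<noteq> 0 \<longrightarrow> eval3 p \<beta> v (s\<^sup>2) = ?ev f \<beta> v s"
    if global: "p \<in> global_functions E" for p
  proof -
    obtain q where q: "\<And>\<gamma> w1 w2. \<gamma> \<noteq> 0 \<Longrightarrow>
        eval3 p (1 / \<gamma>) (w1 / \<gamma>) (\<gamma> ^ 3 * w2 + \<gamma>\<^sup>2 * w1) = eval3 q \<gamma> w1 w2"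
      using global unfolding glob by blast
    \<comment> \<open>Solving \<open>t = v1 - \<beta>^3 * s^2\<close> with
      \<open>\<beta> = x / y\<close> and \<open>s = y\<close> gives
      \<open>v1 = (t * y + x ^ 3) / y\<close>. The order \<open>x, t, y\<close> puts the chart
      denominators first and last.\<close>
    have glue: "eval3 p (x / y) ((t * y + x ^ 3) / y) (y ^ 3 / y)
        = eval3 q (y / x) ((t * y + x ^ 3) / x) (- (t * x) / x)"
      if "x \<noteq> 0" "y \<noteq> 0" for x t y
    proof -
      have "(y / x) ^ 3 * - t + (y / x)\<^sup>2 * ((t * y + x ^ 3) / x) = y ^ 3 / y"
        using that by (simp add: field_simps power2_eq_square power3_eq_cube)
      with q [of "y / x" "(t * y + x ^ 3) / x" "- t"] that show ?thesis by simp
    qed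
    obtain f0 f1 where f: "\<And>x t y u. y \<noteq> 0 \<Longrightarrow> u\<^sup>2 = 1 \<Longrightarrow>
        eval3 f0 x t y + u * eval3 f1 x t y = eval3 p (x / y) ((t * y + x ^ 3) / y) (y ^ 3 / y)"
      by (rule glued_function_extends [of 1 p x1 "x2 * x3 + x1 ^ 3" "x3 ^ 3"
            q x3 "x2 * x3 + x1 ^ 3" "- (x2 * x1)"]) (use glue in auto)
    obtain F where F: "\<And>x y t. eval3 F x y t = eval3 (f0 + f1) x t y"
      using subst33 [of "f0 + f1" t1 t3 t2] unfolding eval3_coordinates by blast
    have F': "eval3 F x y t = eval3 p (x / y) (t + x ^ 3 / y) (y\<^sup>2)" if "y \<noteq> 0" for x y t
      using f [OF that, of 1] that
      by (simp add: F add_divide_distrib power2_eq_square power3_eq_cube)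
    have "eval3 F (\<zeta> * x) (\<zeta> * y) t = eval3 F x y t" if \<zeta>: "\<zeta>\<^sup>2 = 1" for \<zeta> x y t
    proof -
      have "\<zeta> \<noteq> 0" using \<zeta> by auto
      obtain g where g: "\<And>x y t. eval3 g x y t = eval3 F (\<zeta> * x) (\<zeta> * y) t"
        using subst33 [of F "[:[:[:\<zeta>:]:]:] * t1" "[:[:[:\<zeta>:]:]:] * t2" t3]
        unfolding eval3_ring_hom eval3_coordinates eval2_ring_hom by blast
      have "(\<zeta> * x) ^ 3 / (\<zeta> * y) = x ^ 3 / y" for x y
        using \<zeta> \<open>\<zeta> \<noteq> 0\<close> by (simp add: power2_eq_square power3_eq_cube)
      then have "g = F"
        by (intro eval3_eqI_dense [OF t2_nonzero])
          (simp add: g F' \<open>\<zeta> \<noteq> 0\<close> root_power_eq_1 [OF \<zeta>])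
      then show ?thesis using g by metis
    qed
    then have "F \<in> ?S" unfolding inv by blast
    then show ?thesis
      by (intro bexI [of _ F]) (simp_all add: F' power2_eq_square power3_eq_cube)
  qed
  obtain h where h: "h \<in> ring_hom (ring_on ?S) (ring_on (global_functions E))"
    "h ` ?S = global_functions E" "\<And>c. h [:[:[:c:]:]:] = [:[:[:c:]:]:]"
    "\<And>f. f \<in> ?S \<Longrightarrow> h f = 0 \<longleftrightarrow> (\<forall>\<beta> v s. s \<noteq> 0 \<longrightarrow> ?ev f \<beta> v s = 0)"
    by (rule evaluation_hom_exists [of _ "\<lambda>c. [:[:[:c:]:]:]" 2 ?ev, OF S _ _ _ _ _ _ into onto])
      (auto simp: inv)
  have "f = 0" if "f \<in> ?S" "h f = 0" for f
  proof (rule eval3_eqI_dense [OF t2_nonzero])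
    have "?ev f (x / y) (t + (x / y) ^ 3 * y\<^sup>2) y = 0" if "y \<noteq> 0" for x y t
      using h(4) \<open>f \<in> ?S\<close> \<open>h f = 0\<close> that by blast
    then show "eval3 f x y t = eval3 0 x y t" if "eval3 t2 x y t \<noteq> 0" for x y t
      using that by simp
  qed
  then show ?thesis
    unfolding blow_down_def calg3_def
    by (intro calg_iso_injI [OF S _ h(1-3)]) (auto simp: inv)
qed

text \<open>Put \<open>T = \<gamma>^2 * w2 + w1^2\<close>; then \<open>v2 = \<gamma> * T\<close>,
  and \<open>(X, Y, Z, T)\<close> is \<open>(w1 * T, \<gamma> * T, w2, T)\<close> in the second
  chart. The hypersurface equation is the definition of \<open>T\<close> multiplied by
  \<open>T^2\<close>.\<close>

lemma blow_down_D:
  assumes "pderiv E = monom (monom 1 1) 2"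
  shows "blow_down E \<cong>\<^sub>C calg_quot (calg4 UNIV) (x1 ^ 2 + x2 ^ 2 * x3 - x4 ^ 3)"
proof -
  let ?f = "x1\<^sup>2 + x2\<^sup>2 * x3 - x4 ^ 3"
  \<comment> \<open>The hypersurface solved for \<open>X^2\<close>, with base coordinates ordered
    \<open>T, Z, Y\<close> because \<open>T\<close> and \<open>Y\<close> are the chart
    denominators.\<close>
  let ?D = "t1 ^ 3 - t3\<^sup>2 * t2"
  let ?ev = "\<lambda>f \<beta> v s. eval4 f (v * s) s (\<beta> ^ 3 * s - v\<^sup>2) (\<beta> * s)"
  have glob: "p \<in> global_functions E \<longleftrightarrow> (\<exists>q. \<forall>\<gamma> w1 w2. \<gamma> \<noteq> 0 \<longrightarrow>
     eval3 p (1 / \<gamma>) (w1 / \<gamma>) (\<gamma> ^ 3 * w2 + \<gamma> * w1\<^sup>2) = eval3 q \<gamma> w1 w2)" for p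
    by (simp add: global_functions_iff assms eval2_monom)
  have D: "?D \<noteq> 0"
  proof
    assume "?D = 0"
    then have "eval3 ?D 1 0 0 = 0" by (simp only: eval3_ring_hom)
    then show False by simp
  qed
  have S: "closed_ring (UNIV :: complex poly poly poly poly set)"
    by (simp add: closed_ring_def)
  have into: "\<exists>p\<in>global_functions E. \<forall>\<beta> v s. eval3 p \<beta> v (s ^ 1) = ?ev f \<beta> v s" for f
  proof -
    obtain p where p: "\<And>\<beta> v s. eval3 p \<beta> v s = ?ev f \<beta> v s"
      using subst43 [of f "t2 * t3" t3 "t1 ^ 3 * t3 - t2\<^sup>2" "t1 * t3"] by auto
    obtain q where q: "\<And>\<gamma> w1 w2. eval3 q \<gamma> w1 w2 = eval4 f
        (w1 * (\<gamma>\<^sup>2 * w2 + w1\<^sup>2)) (\<gamma> * (\<gamma>\<^sup>2 * w2 + w1\<^sup>2)) w2 (\<gamma>\<^sup>2 * w2 + w1\<^sup>2)"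
      using subst43 [of f "t2 * (t1\<^sup>2 * t3 + t2\<^sup>2)" "t1 * (t1\<^sup>2 * t3 + t2\<^sup>2)" t3 "t1\<^sup>2 * t3 + t2\<^sup>2"]
      by auto
    have "eval3 p (1 / \<gamma>) (w1 / \<gamma>) (\<gamma> ^ 3 * w2 + \<gamma> * w1\<^sup>2) = eval3 q \<gamma> w1 w2"
      if "\<gamma> \<noteq> 0" for \<gamma> w1 w2
    proof -
      have "\<gamma> ^ 3 * w2 + \<gamma> * w1\<^sup>2 = \<gamma> * (\<gamma>\<^sup>2 * w2 + w1\<^sup>2)"
        by (simp add: algebra_simps power2_eq_square power3_eq_cube)
      moreover have "(1 / \<gamma>) ^ 3 * (\<gamma> * (\<gamma>\<^sup>2 * w2 + w1\<^sup>2)) - (w1 / \<gamma>)\<^sup>2 = w2"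
        using that by (simp add: field_simps power2_eq_square power3_eq_cube)
      ultimately show ?thesis
        using that by (simp add: p q)
    qed
    then have "p \<in> global_functions E" unfolding glob by blast
    then show ?thesis using p by auto
  qed
  have onto: "\<exists>f\<in>UNIV. \<forall>\<beta> v s. s \<noteq> 0 \<longrightarrow> eval3 p \<beta> v (s ^ 1) = ?ev f \<beta> v s"
    if global: "p \<in> global_functions E" for p
  proof -
    obtain q where q: "\<And>\<gamma> w1 w2. \<gamma> \<noteq> 0 \<Longrightarrow>
        eval3 p (1 / \<gamma>) (w1 / \<gamma>) (\<gamma> ^ 3 * w2 + \<gamma> * w1\<^sup>2) = eval3 q \<gamma> w1 w2"
      using global unfolding glob by blast
    have glue: "eval3 p (T / Y) (X / Y) (Y\<^sup>2 / Y) = eval3 q (Y / T) (X / T) (Z * T / T)"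
      if "T \<noteq> 0" "Y \<noteq> 0" and X: "X\<^sup>2 = T ^ 3 - Y\<^sup>2 * Z" for T Z Y X
    proof -
      have "(Y / T) ^ 3 * Z + Y / T * (X / T)\<^sup>2 = Y\<^sup>2 / Y"
        unfolding power_divide X using that(1,2)
        by (simp add: field_simps power2_eq_square power3_eq_cube)
      with q [of "Y / T" "X / T" Z] that show ?thesis by simp
    qed
    obtain f0 f1 where f: "\<And>T Z Y X. Y \<noteq> 0 \<Longrightarrow> X\<^sup>2 = T ^ 3 - Y\<^sup>2 * Z \<Longrightarrow>
        eval3 f0 T Z Y + X * eval3 f1 T Z Y = eval3 p (T / Y) (X / Y) (Y\<^sup>2 / Y)"
      by (rule glued_function_extends [of ?D p x1 x4 "x3\<^sup>2" q x3 x4 "x2 * x1"])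
        (use glue D in auto)
    obtain F0 where F0: "\<And>X Y Z T. eval4 F0 X Y Z T = eval3 f0 T Z Y"
      using subst34 [of f0 x4 x3 x2] by auto
    obtain F1 where F1: "\<And>X Y Z T. eval4 F1 X Y Z T = eval3 f1 T Z Y"
      using subst34 [of f1 x4 x3 x2] by auto
    have "eval3 p \<beta> v s = ?ev (F0 + x1 * F1) \<beta> v s" if "s \<noteq> 0" for \<beta> v s
    proof -
      have "(v * s)\<^sup>2 = (\<beta> * s) ^ 3 - s\<^sup>2 * (\<beta> ^ 3 * s - v\<^sup>2)"
        by (simp add: algebra_simps power2_eq_square power3_eq_cube)
      from f [OF that this] that show ?thesis
        by (simp add: F0 F1 power2_eq_square)
    qed
    then show ?thesis
      by (intro bexI [of _ "F0 + x1 * F1"] allI impI) (simp_all only: power_one_right UNIV_I)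
  qed
  obtain h where h: "h \<in> ring_hom (ring_on UNIV) (ring_on (global_functions E))"
    "h ` UNIV = global_functions E" "\<And>c. h [:[:[:[:c:]:]:]:] = [:[:[:c:]:]:]"
    "\<And>f. h f = 0 \<longleftrightarrow> (\<forall>\<beta> v s. s \<noteq> 0 \<longrightarrow> ?ev f \<beta> v s = 0)"
    by (rule evaluation_hom_exists [of _ "\<lambda>c. [:[:[:[:c:]:]:]:]" 1 ?ev, OF S _ _ _ _ _ _ into onto])
      auto
  have ker: "h p = 0 \<longleftrightarrow> (\<exists>q\<in>UNIV. p = q * ?f)" for p
  proof
    assume "h p = 0"
    then have zero: "?ev p \<beta> v s = 0" if "s \<noteq> 0" for \<beta> v s
      using h(4) \<open>h p = 0\<close> that by blast
    \<comment> \<open>Division acts on the outermost variable, so \<open>X\<close> is moved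
      there.\<close>
    obtain p' where p': "\<And>T Z Y X. eval4 p' T Z Y X = eval4 p X Y Z T"
      using subst44 [of p x4 x3 x2 x1] by auto
    have p'0: "eval4 p' T Z Y X = 0"
      if "eval3 t3 T Z Y \<noteq> 0" and X: "X\<^sup>2 = eval3 ?D T Z Y" for T Z Y X
    proof -
      \<comment> \<open>The equation recovers \<open>Z\<close>, so the parametrization reaches every
        point of the hypersurface with \<open>Y \<noteq> 0\<close>.\<close>
      have "(T / Y) ^ 3 * Y - (X / Y)\<^sup>2 = Z"
        unfolding power_divide X using that(1)
        by (simp add: field_simps power2_eq_square power3_eq_cube)
      then show ?thesis
        using zero [where s = Y and \<beta> = "T / Y" and v = "X / Y"] that(1) by (simp add: p')
    qed
    obtain q' where q': "\<And>T Z Y X. eval4 p' T Z Y X = (X\<^sup>2 - eval3 ?D T Z Y) * eval4 q' T Z Y X"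
      using vanishing_on_double_cover [OF D t3_nonzero p'0] by blast
    obtain q where q: "\<And>X Y Z T. eval4 q X Y Z T = eval4 q' T Z Y X"
      using subst44 [of q' x4 x3 x2 x1] by auto
    have "p = q * ?f"
      by (rule eval4_eqI) (simp add: q algebra_simps flip: p', simp add: q' algebra_simps)
    then show "\<exists>q\<in>UNIV. p = q * ?f" by blast
  next
    assume "\<exists>q\<in>UNIV. p = q * ?f"
    moreover have "?ev ?f \<beta> v s = 0" for \<beta> v s
      by (simp add: algebra_simps power2_eq_square power3_eq_cube)
    ultimately show "h p = 0"
      unfolding h(4) by (auto simp del: eval4_ring_hom(1,2) eval4_coordinates)
  qed
  show ?thesis
    unfolding blow_down_def calg3_def calg4_def
    by (intro calg_iso_quotI [OF S _ _ h(1-3) ker]) auto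
qed

text \<open>Here \<open>s = \<gamma> * r\<close> with \<open>r^2 = \<gamma> * w2 + w1^2\<close>, and
  \<open>(a, b, u, v)\<close> is \<open>(\<gamma> * r, r, w1 * r, r * w2)\<close> in the second
  chart; the nontrivial group element changes the sign of \<open>r\<close>.\<close>

lemma blow_down_E:
  assumes "pderiv E = monom (monom 1 2) 2"
  shows "blow_down E \<cong>\<^sub>C calg_quot (calg4 (invariants4 2)) (x2 ^ 4 - x3 ^ 2 - x1 * x4)"
proof -
  let ?S = "invariants4 2"
  let ?f = "x2 ^ 4 - x3\<^sup>2 - x1 * x4"
  let ?D = "t1 ^ 4 - t3 * t2"
  let ?ev = "\<lambda>f \<beta> v s. eval4 f s (\<beta> * s) (v * s) (s * (\<beta> ^ 4 * s\<^sup>2 - v\<^sup>2))"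
  have glob: "p \<in> global_functions E \<longleftrightarrow> (\<exists>q. \<forall>\<gamma> w1 w2. \<gamma> \<noteq> 0 \<longrightarrow>
     eval3 p (1 / \<gamma>) (w1 / \<gamma>) (\<gamma> ^ 3 * w2 + \<gamma>\<^sup>2 * w1\<^sup>2) = eval3 q \<gamma> w1 w2)" for p
    by (simp add: global_functions_iff assms eval2_monom)
  have inv: "f \<in> ?S \<longleftrightarrow> (\<forall>a b u v. eval4 f (- a) (- b) (- u) (- v) = eval4 f a b u v)" for f
    unfolding invariants4_def power2_eq_1_iff by auto
  have D: "?D \<noteq> 0"
  proof
    assume "?D = 0"
    then have "eval3 ?D 1 0 0 = 0" by (simp only: eval3_ring_hom)
    then show False by simp
  qed
  have f0: "?f \<noteq> 0"
  proof
    assume "?f = 0"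
    then have "eval4 ?f 0 1 0 0 = 0" by (simp only: eval4_ring_hom)
    then show False by simp
  qed
  have S: "closed_ring ?S"
    by (simp add: closed_ring_def inv)
  have fS: "?f \<in> ?S"
    by (simp add: inv)
  have into: "\<exists>p\<in>global_functions E. \<forall>\<beta> v s. eval3 p \<beta> v (s\<^sup>2) = ?ev f \<beta> v s"
    if f: "f \<in> ?S" for f
  proof -
    have f': "eval4 f (- a) (- b) (- u) (- v) = eval4 f a b u v" for a b u v
      using f inv by blast
    obtain g where g: "\<And>\<beta> v w s. eval4 g \<beta> v w s = ?ev f \<beta> v s"
      using subst44 [of f x4 "x1 * x4" "x2 * x4" "x4 * (x1 ^ 4 * x4\<^sup>2 - x2\<^sup>2)"] by auto
    have g_inv: "eval4 g \<beta> v w (\<zeta> * s) = eval4 g \<beta> v w s" if "\<zeta>\<^sup>2 = 1" for \<zeta> \<beta> v w s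
      using that f' [of s "\<beta> * s" "v * s" "s * (\<beta> ^ 4 * s\<^sup>2 - v\<^sup>2)"]
      by (auto simp: g power2_eq_1_iff)
    obtain p where p: "\<And>\<beta> v w s. s\<^sup>2 = w \<Longrightarrow> eval4 g \<beta> v w s = eval3 p \<beta> v w"
      by (rule invariant_descends_to_base [of 2 t3 g]) (simp_all add: g_inv)
    obtain g' where g': "\<And>\<gamma> w1 w2 r. eval4 g' \<gamma> w1 w2 r = eval4 f (\<gamma> * r) r (w1 * r) (r * w2)"
      using subst44 [of f "x1 * x4" x4 "x2 * x4" "x4 * x3"] by auto
    have g'_inv: "eval4 g' \<gamma> w1 w2 (\<zeta> * r) = eval4 g' \<gamma> w1 w2 r" if "\<zeta>\<^sup>2 = 1" for \<zeta> \<gamma> w1 w2 r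
      using that f' [of "\<gamma> * r" r "w1 * r" "r * w2"] by (auto simp: g' power2_eq_1_iff)
    obtain q where q: "\<And>\<gamma> w1 w2 r. r\<^sup>2 = \<gamma> * w2 + w1\<^sup>2 \<Longrightarrow> eval4 g' \<gamma> w1 w2 r = eval3 q \<gamma> w1 w2"
      by (rule invariant_descends_to_base [of 2 "t1 * t3 + t2\<^sup>2" g']) (simp_all add: g'_inv)
    have "eval3 p (1 / \<gamma>) (w1 / \<gamma>) (\<gamma> ^ 3 * w2 + \<gamma>\<^sup>2 * w1\<^sup>2) = eval3 q \<gamma> w1 w2"
      if "\<gamma> \<noteq> 0" for \<gamma> w1 w2
    proof -
      obtain r where r: "r\<^sup>2 = \<gamma> * w2 + w1\<^sup>2" using complex_root_exists [of 2] by auto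
      then have s: "(\<gamma> * r)\<^sup>2 = \<gamma> ^ 3 * w2 + \<gamma>\<^sup>2 * w1\<^sup>2"
        by (simp add: power_mult_distrib algebra_simps power2_eq_square power3_eq_cube)
      have "\<gamma> * ((1 / \<gamma>) ^ 4 * (\<gamma> * r)\<^sup>2 - (w1 / \<gamma>)\<^sup>2) = w2"
        unfolding s using that
        by (simp add: field_simps power2_eq_square power3_eq_cube power4_eq_xxxx)
      then have eq: "\<gamma> * r * ((1 / \<gamma>) ^ 4 * (\<gamma> * r)\<^sup>2 - (w1 / \<gamma>)\<^sup>2) = r * w2"
        by (metis mult.assoc mult.commute)
      have "?ev f (1 / \<gamma>) (w1 / \<gamma>) (\<gamma> * r) = eval4 g' \<gamma> w1 w2 r"
        by (simp only: g' eq) (use that in simp)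
      moreover have "eval3 p (1 / \<gamma>) (w1 / \<gamma>) (\<gamma> ^ 3 * w2 + \<gamma>\<^sup>2 * w1\<^sup>2) =
          ?ev f (1 / \<gamma>) (w1 / \<gamma>) (\<gamma> * r)"
        using p [OF s] g by metis
      ultimately show ?thesis
        using q [OF r] by simp
    qed
    then have "p \<in> global_functions E" unfolding glob by blast
    then show ?thesis using p by (auto simp: g)
  qed
  have onto: "\<exists>f\<in>?S. \<forall>\<beta> v s. s \<noteq> 0 \<longrightarrow> eval3 p \<beta> v (s\<^sup>2) = ?ev f \<beta> v s"
    if global: "p \<in> global_functions E" for p
  proof -
    obtain q where q: "\<And>\<gamma> w1 w2. \<gamma> \<noteq> 0 \<Longrightarrow>
        eval3 p (1 / \<gamma>) (w1 / \<gamma>) (\<gamma> ^ 3 * w2 + \<gamma>\<^sup>2 * w1\<^sup>2) = eval3 q \<gamma> w1 w2"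
      using global unfolding glob by blast
    \<comment> \<open>\<open>v2 = a^2\<close> and \<open>w2 = v / b\<close>; the cover is
      \<open>u^2 = b^4 - a * v\<close>, with denominators \<open>a\<close> and
      \<open>b\<close>.\<close>
    have glue: "eval3 p (b / a) (u / a) (a ^ 3 / a) = eval3 q (a / b) (u / b) (v / b)"
      if "b \<noteq> 0" "a \<noteq> 0" and u: "u\<^sup>2 = b ^ 4 - a * v" for b v a u
    proof -
      have "(a / b) ^ 3 * (v / b) + (a / b)\<^sup>2 * (u / b)\<^sup>2 = a ^ 3 / a"
        unfolding power_divide u using that(1,2)
        by (simp add: field_simps power2_eq_square power3_eq_cube power4_eq_xxxx)
      with q [of "a / b" "u / b" "v / b"] that show ?thesis by simp
    qed
    obtain f0 f1 where f: "\<And>b v a u. a \<noteq> 0 \<Longrightarrow> u\<^sup>2 = b ^ 4 - a * v \<Longrightarrow>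
        eval3 f0 b v a + u * eval3 f1 b v a = eval3 p (b / a) (u / a) (a ^ 3 / a)"
      by (rule glued_function_extends [of ?D p x1 x4 "x3 ^ 3" q x3 x4 x2])
        (use glue D in auto)
    obtain f0' where f0': "\<And>b v a. eval3 f0' b v a = eval3 f0 (- b) (- v) (- a)"
      using subst33 [of f0 "- t1" "- t2" "- t3"] by auto
    obtain f1' where f1': "\<And>b v a. eval3 f1' b v a = eval3 f1 (- b) (- v) (- a)"
      using subst33 [of f1 "- t1" "- t2" "- t3"] by auto
    \<comment> \<open>The involution also negates \<open>u\<close>. As \<open>1\<close> and
      \<open>u\<close> are independent, invariance of \<open>f0 + u * f1\<close> makes
      \<open>f0\<close> even and \<open>f1\<close> odd.\<close>
    have even: "eval3 (f0' - f0) b v a + u * eval3 (- (f1' + f1)) b v a = 0"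
      if "eval3 t3 b v a \<noteq> 0" and u: "u\<^sup>2 = eval3 ?D b v a" for b v a u
    proof -
      have "(- a) ^ 3 / - a = a ^ 3 / a"
        by (simp add: power3_eq_cube)
      then have "eval3 f0 (- b) (- v) (- a) - u * eval3 f1 (- b) (- v) (- a)
          = eval3 f0 b v a + u * eval3 f1 b v a"
        using f [of "- a" "- u" "- b" "- v"] f [of a u b v] that by simp
      then show ?thesis
        by (simp add: f0' f1' algebra_simps)
    qed
    have "f0' = f0" "f1' = - f1"
      using double_cover_zero [OF D t3_nonzero even] by auto
    then have f_even: "eval3 f0 (- b) (- v) (- a) = eval3 f0 b v a"
      "eval3 f1 (- b) (- v) (- a) = - eval3 f1 b v a" for b v a
      by (simp_all flip: f0' f1')
    obtain F0 where F0: "\<And>a b u v. eval4 F0 a b u v = eval3 f0 b v a"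
      using subst34 [of f0 x2 x4 x1] by auto
    obtain F1 where F1: "\<And>a b u v. eval4 F1 a b u v = eval3 f1 b v a"
      using subst34 [of f1 x2 x4 x1] by auto
    have "F0 + x3 * F1 \<in> ?S"
      by (simp add: inv F0 F1 f_even)
    moreover have "eval3 p \<beta> v (s\<^sup>2) = ?ev (F0 + x3 * F1) \<beta> v s" if "s \<noteq> 0" for \<beta> v s
    proof -
      have "(v * s)\<^sup>2 = (\<beta> * s) ^ 4 - s * (s * (\<beta> ^ 4 * s\<^sup>2 - v\<^sup>2))"
        by (simp add: algebra_simps power2_eq_square power4_eq_xxxx)
      from f [OF that this] that show ?thesis
        by (simp add: F0 F1 power2_eq_square power3_eq_cube)
    qed
    ultimately show ?thesis by blast
  qed
  obtain h where h: "h \<in> ring_hom (ring_on ?S) (ring_on (global_functions E))"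
    "h ` ?S = global_functions E" "\<And>c. h [:[:[:[:c:]:]:]:] = [:[:[:c:]:]:]"
    "\<And>f. f \<in> ?S \<Longrightarrow> h f = 0 \<longleftrightarrow> (\<forall>\<beta> v s. s \<noteq> 0 \<longrightarrow> ?ev f \<beta> v s = 0)"
    by (rule evaluation_hom_exists [of _ "\<lambda>c. [:[:[:[:c:]:]:]:]" 2 ?ev, OF S _ _ _ _ _ _ into onto])
      (auto simp: inv)
  have ker: "h p = 0 \<longleftrightarrow> (\<exists>q\<in>?S. p = q * ?f)" if pS: "p \<in> ?S" for p
  proof
    assume "h p = 0"
    then have zero: "?ev p \<beta> v s = 0" if "s \<noteq> 0" for \<beta> v s
      using h(4) [OF pS] that by blast
    obtain p' where p': "\<And>b v a u. eval4 p' b v a u = eval4 p a b u v"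
      using subst44 [of p x3 x1 x4 x2] by auto
    have p'0: "eval4 p' b v a u = 0"
      if "eval3 t3 b v a \<noteq> 0" and u: "u\<^sup>2 = eval3 ?D b v a" for b v a u
    proof -
      have "a * ((b / a) ^ 4 * a\<^sup>2 - (u / a)\<^sup>2) = v"
        unfolding power_divide u using that(1)
        by (simp add: field_simps power2_eq_square power4_eq_xxxx)
      then show ?thesis
        using zero [where s = a and \<beta> = "b / a" and v = "u / a"] that(1) by (simp add: p')
    qed
    obtain q' where q': "\<And>b v a u. eval4 p' b v a u = (u\<^sup>2 - eval3 ?D b v a) * eval4 q' b v a u"
      using vanishing_on_double_cover [OF D t3_nonzero p'0] by blast
    \<comment> \<open>The sign appears because \<open>u^2 - D\<close> is the negative of
      \<open>?f\<close>.\<close>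
    obtain q where q: "\<And>a b u v. eval4 q a b u v = - eval4 q' b v a u"
      using subst44 [of "- q'" x2 x4 x1 x3] by auto
    have pq: "p = q * ?f"
      by (rule eval4_eqI) (simp add: q algebra_simps flip: p', simp add: q' algebra_simps)
    \<comment> \<open>The reflection \<open>r\<close> of \<open>q\<close> is also a cofactor of
      \<open>p\<close>, both \<open>p\<close> and \<open>?f\<close> being invariant; cancelling
      \<open>?f\<close> shows that \<open>q\<close> is invariant.\<close>
    obtain r where r: "\<And>a b u v. eval4 r a b u v = eval4 q (- a) (- b) (- u) (- v)"
      using subst44 [of q "- x1" "- x2" "- x3" "- x4"] by auto
    have "r * ?f = q * ?f"
    proof (rule eval4_eqI)
      fix a b u v
      have "eval4 (q * ?f) (- a) (- b) (- u) (- v) = eval4 (q * ?f) a b u v"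
        using pS pq inv by blast
      then show "eval4 (r * ?f) a b u v = eval4 (q * ?f) a b u v"
        by (simp add: r)
    qed
    then have "r = q" using f0 by simp
    then have "q \<in> ?S" using r by (simp add: inv)
    then show "\<exists>q\<in>?S. p = q * ?f" using pq by blast
  next
    assume "\<exists>q\<in>?S. p = q * ?f"
    then obtain q where p: "p = q * ?f" by blast
    have "?ev ?f \<beta> v s = 0" for \<beta> v s
      by (simp add: algebra_simps power2_eq_square power4_eq_xxxx)
    then show "h p = 0"
      unfolding h(4) [OF pS] unfolding p eval4_ring_hom(4) by simp
  qed
  show ?thesis
    unfolding blow_down_def calg3_def calg4_def
    by (intro calg_iso_quotI [OF S fS _ h(1-3) ker]) (simp_all add: inv)
qed

section \<open>Superpotentials of monomial perturbations\<close>

lemma superpotential_monom: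
  assumes "n \<le> 2" "2 - n \<le> m"
  shows "superpotential (monom (monom c n) m) x y =
    c * of_nat (m choose (2 - n)) * x ^ (m - (2 - n)) * y ^ (2 - n)"
  \<comment> \<open>Only the term with \<open>\<gamma> ^ (2 - n)\<close> in the binomial expansion
    of \<open>(x + \<gamma> * y) ^ m\<close> contributes; the bounds keep the subtractions
    exact.\<close>
  using assms
  by (simp add: superpotential_def poly_monom coeff_monom_mult coeff_linear_poly_power)

lemma pderiv_monom_monom:
  "pderiv (monom (monom c n) m) = monom (monom (of_nat m * c) n) (m - 1)"
  by (simp add: pderiv_monom of_nat_mult_conv_smult smult_monom)

text \<open>Integration in \<open>w1\<close> gives the witness. Its superpotential is
  \<open>x^2 / 2\<close>, matching after interchange of \<open>x\<close> and \<open>y\<close>; the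
  next two cases likewise give \<open>x^2 * y\<close> and \<open>x^3 / 3\<close>.\<close>

lemma perturbation_A:
  "\<exists>E. pderiv E = monom (monom 1 2) 1 \<and> has_superpotential E (\<lambda>x y. 1 / 2 * y ^ 2)"
  by (rule exI [of _ "monom (monom (1 / 2) 2) 2"])
    (simp add: pderiv_monom_monom has_superpotential_def superpotential_monom fun_eq_iff)

lemma perturbation_D:
  "\<exists>E. pderiv E = monom (monom 1 1) 2 \<and> has_superpotential E (\<lambda>x y. x * y ^ 2)"
  by (rule exI [of _ "monom (monom (1 / 3) 1) 3"])
    (simp add: pderiv_monom_monom has_superpotential_def superpotential_monom fun_eq_iff)

lemma perturbation_E:
  "\<exists>E. pderiv E = monom (monom 1 2) 2 \<and> has_superpotential E (\<lambda>x y. 1 / 3 * y ^ 3)"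
  by (rule exI [of _ "monom (monom (1 / 3) 2) 3"])
    (simp add: pderiv_monom_monom has_superpotential_def superpotential_monom fun_eq_iff)

theorem theorem3:
  shows
   "((\<exists>E. pderiv E = 0 \<and> has_superpotential E (\<lambda>x y. 0)) \<and>
     (\<forall>E. pderiv E = 0 \<longrightarrow>
        blow_down E \<cong>\<^sub>C calg3 (invariants3 3)))
    \<and>
    ((\<exists>E. pderiv E = monom (monom 1 2) 1 \<and> has_superpotential E (\<lambda>x y. 1 / 2 * y ^ 2)) \<and>
     (\<forall>E. pderiv E = monom (monom 1 2) 1 \<longrightarrow>
        blow_down E \<cong>\<^sub>C calg3 (polys_over (invariants2 2))))
    \<and>
    ((\<exists>E. pderiv E = monom (monom 1 1) 2 \<and> has_superpotential E (\<lambda>x y. x * y ^ 2)) \<and>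
     (\<forall>E. pderiv E = monom (monom 1 1) 2 \<longrightarrow>
        blow_down E \<cong>\<^sub>C calg_quot (calg4 UNIV) (x1 ^ 2 + x2 ^ 2 * x3 - x4 ^ 3)))
    \<and>
    ((\<exists>E. pderiv E = monom (monom 1 2) 2 \<and> has_superpotential E (\<lambda>x y. 1 / 3 * y ^ 3)) \<and>
     (\<forall>E. pderiv E = monom (monom 1 2) 2 \<longrightarrow>
        blow_down E \<cong>\<^sub>C calg_quot (calg4 (invariants4 2)) (x2 ^ 4 - x3 ^ 2 - x1 * x4)))"
proof -
  have "pderiv 0 = 0 \<and> has_superpotential 0 (\<lambda>x y. 0)"
    by (simp add: has_superpotential_def superpotential_def fun_eq_iff)
  then show ?thesis
    using perturbation_A perturbation_D perturbation_E
      blow_down_O blow_down_A blow_down_D blow_down_E by blast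
qed

end
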